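(* Let $f,g$ satisfy Assumption A, let $\tau\in(0,2)$ and let $H_1,\dots,H_4$ be as in the context. Consider the sequence $\{(\bm{x}^k,\lambda^k)\}$ generated by the algorithm (PRADMM) of the context with penalty parameter $\beta>0$, which is assumed to be bounded (contained, as regards $\bm{x}^k$, in the bounded set $B_R$ of the context). Then there exists a constant $\underline{\beta}>0$ such that for all $\beta>\underline{\beta}$: (i) $\{\Psi^k\}$ is nonincreasing; more precisely, there are constants $0<\delta_i<1$ ($i=1,\dots,4$) such that for all $k\ge 1$ $$\Psi^{k}-\Psi^{k+1}\ \ge\ \sum_{i=1}^4 (1-\delta_i)\,\|\Delta x_i^{k}\|_{M_i}^2,$$ and the right-hand side is nonnegative. (ii) The sequences $\{\Delta x_i^k\}$ ($i=1,\dots,4$) and $\{\Delta\lambda^k\}$ converge to $0$. (iii) Every limit point of $\{(\bm{x}^k,\lambda^k)\}$ is a stationary point of $\mathcal{L}_\beta$.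
   Context: Setting. Let $n\ge1$, $n_1=n_2=4n$, $n_3=n_4=3n$. $\mathcal{M}\subseteq\mathbb{R}^{n_1}$ is a smooth Riemannian submanifold embedded in Euclidean space (in the motivating pose graph problem, $\mathcal{M}$ is the Cartesian product of $n$ unit spheres of $\mathbb{R}^4$). Put $\mathcal{X}_1=\mathcal{M}$ and $\mathcal{X}_i=\mathbb{R}^{n_i}$ for $i=2,3,4$. Write $\bm{x}=(x_1,x_2,x_3,x_4)$, $x_i\in\mathbb{R}^{n_i}$; $\bm{x}_{-i}$ is $\bm{x}$ with block $i$ removed. The problem is $$\min f(x_1,x_2,x_3,x_4)+g(x_1,x_2)\quad\text{s.t.}\quad \sum_{i=1}^4A_ix_i=0,\ x_1\in\mathcal{M},$$ where the $A_i$ are the matrices with $7n$ rows such that $\sum_{i=1}^4A_ix_i=(x_1-x_2,\;x_3-x_4)\in\mathbb{R}^{4n}\times\mathbb{R}^{3n}$. The augmented Lagrangian is $$\mathcal{L}_\beta(\bm{x},\lambda)=f(\bm{x})+g(x_1,x_2)-\Big\langle\lambda,\sum_{i}A_ix_i\Big\rangle+\frac{\beta}{2}\Big\|\sum_{i}A_ix_i\Big\|^2,\quad\lambda\in\mathbb{R}^{7n}.$$ For symmetric $M$, $\|x\|_M^2:=\langle x,Mx\rangle$. Algorithm (PRADMM). Given $\beta>0$, $\tau\in(0,2)$, positive definite diagonal matrices $H_1,\dots,H_4$ (block diagonal, each vertex block being a positive multiple of the identity), and a starting point, for $k=0,1,2,\dots$: for $i=1,2,3,4$ successively, $$x_i^{k+1}\in\arg\min_{x_i\in\mathcal{X}_i}\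 \mathcal{L}_\beta(x_1^{k+1},\dots,x_{i-1}^{k+1},x_i,x_{i+1}^k,\dots,x_4^k,\lambda^k)+\tfrac12\|x_i-x_i^k\|_{H_i}^2,$$ then $\lambda^{k+1}=\lambda^k-\tau\beta\sum_{i=1}^4A_ix_i^{k+1}$. Denote $\Delta x_i^k=x_i^k-x_i^{k-1}$, $\Delta\bm{x}^k=\bm{x}^k-\bm{x}^{k-1}$, $\Delta\lambda^k=\lambda^k-\lambda^{k-1}$. Assumption A. (i) $f,g$ are proper, lower semicontinuous and bounded below on the feasible region: $f^*=\inf_{x_i\in\mathcal{X}_i}f>-\infty$, $g^*=\inf_{x_i\in\mathcal{X}_i}g>-\infty$. (ii) $\nabla f$ is Lipschitz continuous on bounded subsets of $\mathbb{R}^{n_1}\times\cdots\times\mathbb{R}^{n_4}$ with constant $L_f>0$: $\|\nabla f(\bm{x})-\nabla f(\bm{y})\|\le L_f\|\bm{x}-\bm{y}\|$; similarly $\nabla g$ is Lipschitz on bounded subsets of $\mathbb{R}^{n_1}\times\mathbb{R}^{n_2}$ with constant $L_g>0$. (iii) For fixed $\bm{x}_{-i}$, the partial gradient $\nabla_if(\cdot,\bm{x}_{-i})$ is globally Lipschitz on $\mathbb{R}^{n_i}$ with a constant $L_{f,i}(\bm{x}_{-i})>0$ ($i=1,\dots,4$); similarly $\nabla_1g(\cdot,x_2)$, $\nabla_2g(x_1,\cdot)$ are globally Lipschitz with constants $L_{g,1}(x_2)>0$, $L_{g,2}(x_1)>0$. (iv) When $\bm{x}_{-i}$ ranges over a bounded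 subset, these constants have uniform upper bounds: $\sup L_{f,i}(\bm{x}_{-i})\le L_{f,i}$, $\sup L_{g,i}\le L_{g,i}$. (v) $f$ and $g$ are block multi-convex: for each block $i$ with the others fixed, $f(y_i,\bm{x}_{-i})\ge f(x_i,\bm{x}_{-i})+\langle\nabla_if(x_i,\bm{x}_{-i}),y_i-x_i\rangle$ for all $x_i,y_i\in\mathbb{R}^{n_i}$, and likewise for $g$. Convention on constants. Fix $R>0$ and $B_R=\{\bm{x}:\|x_i\|\le R,\ i=1,\dots,4\}$; $L_f,L_g,L_{f,i},L_{g,i}$ are the constants in (ii), (iv) for $B_R$. A bounded sequence is one lying in such a $B_R$, with $\{\lambda^k\}$ bounded too. The constant $\underline\beta$ is allowed to depend on $\tau$, the $H_i$ and these Lipschitz constants. Lyapunov function. Let $\alpha_1=\frac{|1-\tau|}{1-|1-\tau|}$, $\alpha_2=\frac{\tau}{(1-|1-\tau|)^2}$, and $$M_1=\tfrac12H_1-\tfrac{\alpha_2}{\beta}(7L_f^2+4L_g^2)I,\qquad M_2=H_2-\tfrac{\alpha_2}{\beta}(7L_f^2I+4L_g^2I+4H_2^\top H_2),$$ $$M_3=H_3-\tfrac{3\alpha_2}{\beta}L_f^2I,\qquad M_4=H_4-\tfrac{\alpha_2}{\beta}(3L_f^2I+3H_4^\top H_4).$$ For $k\ge1$, $$\Psi^k=\mathcal{L}_\beta(\bm{x}^k,\lambda^k)+\frac{\alpha_1}{\tau\beta}\|\Delta\lambda^k\|^2+\sum_{i=1}^4\|\Delta x_i^k\|_{M_i}^2.$$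 Stationary point. $(\hat{\bm{x}},\hat\lambda)$ with $\hat x_1\in\mathcal{M}$ is a stationary point of $\mathcal{L}_\beta$ if $\sum_iA_i\hat x_i=0$, $\operatorname{Proj}_{T_{\hat x_1}\mathcal{M}}\big(\nabla_1f(\hat{\bm{x}})+\nabla_1g(\hat x_1,\hat x_2)-A_1^\top\hat\lambda\big)=0$, $\nabla_2f(\hat{\bm{x}})+\nabla_2g(\hat x_1,\hat x_2)-A_2^\top\hat\lambda=0$, $\nabla_3f(\hat{\bm{x}})-A_3^\top\hat\lambda=0$, $\nabla_4f(\hat{\bm{x}})-A_4^\top\hat\lambda=0$, where $\operatorname{Proj}$ is orthogonal projection onto the tangent space.
   Formalization: In (iii), a limit point is claimed to be stationary only if the manifold M is closed or the limit point's first block lies in M; for non-closed M (e.g. R^4 minus a point) limit points can leave M and the unrestricted claim is false. *)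

theory Defs
  imports "HOL-Analysis.Analysis"
begin

section \<open>Smooth embedded submanifolds\<close>

text \<open>Continuous differentiability of order \<open>k\<close>, intended for open \<open>U\<close> in a Euclidean space.
  There, \<open>f\<close> is \<open>C\<close> of order \<open>k + 1\<close> iff it is differentiable and all its directional derivatives
  are \<open>C\<close> of order \<open>k\<close>; stating it direction by direction avoids iterated operator types.\<close>

fun C_order_on ::
  "nat \<Rightarrow> ('a::real_normed_vector \<Rightarrow> 'b::real_normed_vector) \<Rightarrow> 'a set \<Rightarrow> bool" where
  "C_order_on 0 f U \<longleftrightarrow> continuous_on U f"
| "C_order_on (Suc k) f U \<longleftrightarrow>
     f differentiable_on U \<and> (\<forall>v. C_order_on k (\<lambda>x. frechet_derivative f (at x) v) U)"

definition smooth_on ::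
  "('a::real_normed_vector \<Rightarrow> 'b::real_normed_vector) \<Rightarrow> 'a set \<Rightarrow> bool" where
  "smooth_on f U \<longleftrightarrow> (\<forall>k. C_order_on k f U)"

text \<open>Slice charts: near each of its points, \<open>M\<close> is carried to a \<open>d\<close>-dimensional linear subspace
  by a diffeomorphism of open subsets of the ambient space. The dimension \<open>d\<close> is the same at all
  points. \<open>M\<close> need not be closed.\<close>

definition embedded_submanifold :: "'a::euclidean_space set \<Rightarrow> bool" where
  "embedded_submanifold M \<longleftrightarrow>
     (\<exists>d. \<forall>p\<in>M. \<exists>U (V :: 'a set) \<phi> \<psi> S.
        open U \<and> p \<in> U \<and> open V \<and> homeomorphism U V \<phi> \<psi> \<and> smooth_on \<phi> U \<and> smooth_on \<psi> V \<and>
        subspace S \<and> dim S = d \<and> \<phi> ` (U \<inter> M) = V \<inter> S)"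

definition tangent_space :: "'a::euclidean_space set \<Rightarrow> 'a \<Rightarrow> 'a set" where
  "tangent_space M p =
     {v. \<exists>\<gamma> \<epsilon>. 0 < \<epsilon> \<and> smooth_on \<gamma> {-\<epsilon><..<\<epsilon>} \<and> \<gamma> 0 = p \<and> (\<forall>t\<in>{-\<epsilon><..<\<epsilon>}. \<gamma> t \<in> M) \<and>
        (\<gamma> has_vector_derivative v) (at 0)}"

definition orth_proj :: "'a::real_inner set \<Rightarrow> 'a \<Rightarrow> 'a" where
  "orth_proj S w = (THE u. u \<in> S \<and> (\<forall>v\<in>S. inner (w - u) v = 0))"


section \<open>The problem\<close>

text \<open>With \<open>n = CARD('n)\<close>, the index type \<open>'n \<times> 4\<close> (vertex, coordinate) has \<open>4n\<close> elements,
  \<open>'n \<times> 3\<close> has \<open>3n\<close>, and their sum has \<open>7n\<close>.\<close>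

type_synonym 'n vec4 = "real ^ ('n \<times> 4)"
type_synonym 'n vec3 = "real ^ ('n \<times> 3)"
type_synonym 'n dual = "real ^ ('n \<times> 4 + 'n \<times> 3)"
type_synonym 'n point = "'n vec4 \<times> 'n vec4 \<times> 'n vec3 \<times> 'n vec3"

definition A1 :: "real ^ ('n::finite \<times> 4) ^ ('n \<times> 4 + 'n \<times> 3)" where
  "A1 = (\<chi> r c. case r of Inl i \<Rightarrow> if i = c then 1 else 0 | Inr _ \<Rightarrow> 0)"

definition A2 :: "real ^ ('n::finite \<times> 4) ^ ('n \<times> 4 + 'n \<times> 3)" where
  "A2 = (\<chi> r c. case r of Inl i \<Rightarrow> if i = c then -1 else 0 | Inr _ \<Rightarrow> 0)"

definition A3 :: "real ^ ('n::finite \<times> 3) ^ ('n \<times> 4 + 'n \<times> 3)" where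
  "A3 = (\<chi> r c. case r of Inl _ \<Rightarrow> 0 | Inr j \<Rightarrow> if j = c then 1 else 0)"

definition A4 :: "real ^ ('n::finite \<times> 3) ^ ('n \<times> 4 + 'n \<times> 3)" where
  "A4 = (\<chi> r c. case r of Inl _ \<Rightarrow> 0 | Inr j \<Rightarrow> if j = c then -1 else 0)"

definition residual ::
  "'n::finite vec4 \<Rightarrow> 'n vec4 \<Rightarrow> 'n vec3 \<Rightarrow> 'n vec3 \<Rightarrow> 'n dual" where
  "residual x1 x2 x3 x4 = A1 *v x1 + A2 *v x2 + A3 *v x3 + A4 *v x4"

lemma residual_nth:
  "residual x1 x2 x3 x4 $ Inl i = x1 $ i - x2 $ i"
  "residual x1 x2 x3 x4 $ Inr j = x3 $ j - x4 $ j"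
proof -
  have delta: "(\<Sum>c\<in>UNIV. (if a = c then s else 0) * v $ c) = s * v $ a"
    for a :: "'k::finite" and s :: real and v :: "real ^ 'k"
  proof -
    have "(\<Sum>c\<in>UNIV. (if a = c then s else 0) * v $ c) = (\<Sum>c\<in>UNIV. if a = c then s * v $ c else 0)"
      by (intro sum.cong) auto
    then show ?thesis by simp
  qed
  show "residual x1 x2 x3 x4 $ Inl i = x1 $ i - x2 $ i"
    by (simp add: residual_def A1_def A2_def A3_def A4_def matrix_vector_mult_def delta)
  show "residual x1 x2 x3 x4 $ Inr j = x3 $ j - x4 $ j"
    by (simp add: residual_def A1_def A2_def A3_def A4_def matrix_vector_mult_def delta)
qed

definition auglag ::
  "('n::finite point \<Rightarrow> real) \<Rightarrow> ('n vec4 \<times> 'n vec4 \<Rightarrow> real) \<Rightarrow> real \<Rightarrow>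
   'n vec4 \<Rightarrow> 'n vec4 \<Rightarrow> 'n vec3 \<Rightarrow> 'n vec3 \<Rightarrow> 'n dual \<Rightarrow> real" where
  "auglag f g \<beta> x1 x2 x3 x4 lam =
     f (x1, x2, x3, x4) + g (x1, x2) - inner lam (residual x1 x2 x3 x4)
       + \<beta> / 2 * (norm (residual x1 x2 x3 x4))\<^sup>2"


section \<open>Gradients and the standing assumption\<close>

definition grad :: "('a::real_inner \<Rightarrow> real) \<Rightarrow> 'a \<Rightarrow> 'a" where
  "grad F x = (THE D. GDERIV F x :> D)"

definition grad_f1 :: "('n::finite point \<Rightarrow> real) \<Rightarrow> 'n vec4 \<Rightarrow> 'n vec4 \<Rightarrow> 'n vec3 \<Rightarrow> 'n vec3 \<Rightarrow> 'n vec4"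
  where "grad_f1 f x1 x2 x3 x4 = grad (\<lambda>y. f (y, x2, x3, x4)) x1"

definition grad_f2 :: "('n::finite point \<Rightarrow> real) \<Rightarrow> 'n vec4 \<Rightarrow> 'n vec4 \<Rightarrow> 'n vec3 \<Rightarrow> 'n vec3 \<Rightarrow> 'n vec4"
  where "grad_f2 f x1 x2 x3 x4 = grad (\<lambda>y. f (x1, y, x3, x4)) x2"

definition grad_f3 :: "('n::finite point \<Rightarrow> real) \<Rightarrow> 'n vec4 \<Rightarrow> 'n vec4 \<Rightarrow> 'n vec3 \<Rightarrow> 'n vec3 \<Rightarrow> 'n vec3"
  where "grad_f3 f x1 x2 x3 x4 = grad (\<lambda>y. f (x1, x2, y, x4)) x3"

definition grad_f4 :: "('n::finite point \<Rightarrow> real) \<Rightarrow> 'n vec4 \<Rightarrow> 'n vec4 \<Rightarrow> 'n vec3 \<Rightarrow> 'n vec3 \<Rightarrow> 'n vec3"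
  where "grad_f4 f x1 x2 x3 x4 = grad (\<lambda>y. f (x1, x2, x3, y)) x4"

definition grad_g1 :: "('n::finite vec4 \<times> 'n vec4 \<Rightarrow> real) \<Rightarrow> 'n vec4 \<Rightarrow> 'n vec4 \<Rightarrow> 'n vec4"
  where "grad_g1 g x1 x2 = grad (\<lambda>y. g (y, x2)) x1"

definition grad_g2 :: "('n::finite vec4 \<times> 'n vec4 \<Rightarrow> real) \<Rightarrow> 'n vec4 \<Rightarrow> 'n vec4 \<Rightarrow> 'n vec4"
  where "grad_g2 g x1 x2 = grad (\<lambda>y. g (x1, y)) x2"

text \<open>Lipschitz on every bounded set; \<open>L\<close> is the constant for the particular set \<open>B\<close>.\<close>

definition lipschitz_on_bounded ::
  "'a::metric_space set \<Rightarrow> real \<Rightarrow> ('a \<Rightarrow> 'b::metric_space) \<Rightarrow> bool" where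
  "lipschitz_on_bounded B L G \<longleftrightarrow>
     (\<forall>S. bounded S \<longrightarrow> (\<exists>K>0. K-lipschitz_on S G)) \<and> 0 < L \<and> L-lipschitz_on B G"

text \<open>\<open>G z\<close> is globally Lipschitz for each value \<open>z\<close> of the remaining blocks, with constants
  \<open>l z\<close> that are bounded when \<open>z\<close> ranges over a bounded set; \<open>L\<close> bounds them on \<open>B\<close>.\<close>

definition block_lipschitz ::
  "'z::metric_space set \<Rightarrow> real \<Rightarrow> ('z \<Rightarrow> 'a::metric_space \<Rightarrow> 'b::metric_space) \<Rightarrow> bool" where
  "block_lipschitz B L G \<longleftrightarrow>
     (\<exists>l. (\<forall>z. 0 < l z \<and> (l z)-lipschitz_on UNIV (G z)) \<and>
          (\<forall>S. bounded S \<longrightarrow> bdd_above (l ` S)) \<and>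
          (\<forall>z\<in>B. l z \<le> L))"

definition multiconvex_f :: "('n::finite point \<Rightarrow> real) \<Rightarrow> bool" where
  "multiconvex_f f \<longleftrightarrow>
     (\<forall>x1 x2 x3 x4.
       (\<forall>y. f (y, x2, x3, x4) \<ge> f (x1, x2, x3, x4) + inner (grad_f1 f x1 x2 x3 x4) (y - x1)) \<and>
       (\<forall>y. f (x1, y, x3, x4) \<ge> f (x1, x2, x3, x4) + inner (grad_f2 f x1 x2 x3 x4) (y - x2)) \<and>
       (\<forall>y. f (x1, x2, y, x4) \<ge> f (x1, x2, x3, x4) + inner (grad_f3 f x1 x2 x3 x4) (y - x3)) \<and>
       (\<forall>y. f (x1, x2, x3, y) \<ge> f (x1, x2, x3, x4) + inner (grad_f4 f x1 x2 x3 x4) (y - x4)))"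

definition multiconvex_g :: "('n::finite vec4 \<times> 'n vec4 \<Rightarrow> real) \<Rightarrow> bool" where
  "multiconvex_g g \<longleftrightarrow>
     (\<forall>x1 x2.
       (\<forall>y. g (y, x2) \<ge> g (x1, x2) + inner (grad_g1 g x1 x2) (y - x1)) \<and>
       (\<forall>y. g (x1, y) \<ge> g (x1, x2) + inner (grad_g2 g x1 x2) (y - x2)))"

text \<open>The functions are real-valued and differentiable everywhere, hence proper and (lower semi-)
  continuous. The products of balls are the set of all points whose blocks have norm at most \<open>R\<close>,
  and its projections to the relevant blocks.\<close>

definition assumption_A ::
  "'n::finite vec4 set \<Rightarrow> ('n point \<Rightarrow> real) \<Rightarrow> ('n vec4 \<times> 'n vec4 \<Rightarrow> real) \<Rightarrow> real \<Rightarrow>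
   real \<Rightarrow> real \<Rightarrow> real \<Rightarrow> real \<Rightarrow> real \<Rightarrow> real \<Rightarrow> real \<Rightarrow> real \<Rightarrow> bool" where
  "assumption_A M f g R Lf Lg Lf1 Lf2 Lf3 Lf4 Lg1 Lg2 \<longleftrightarrow>
     (\<forall>x. f differentiable at x) \<and> (\<forall>x. g differentiable at x) \<and>
     bdd_below (f ` (M \<times> UNIV \<times> UNIV \<times> UNIV)) \<and> bdd_below (g ` (M \<times> UNIV)) \<and>
     lipschitz_on_bounded (cball 0 R \<times> cball 0 R \<times> cball 0 R \<times> cball 0 R) Lf (grad f) \<and>
     lipschitz_on_bounded (cball 0 R \<times> cball 0 R) Lg (grad g) \<and>
     block_lipschitz (cball 0 R \<times> cball 0 R \<times> cball 0 R) Lf1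
       (\<lambda>(x2, x3, x4) x1. grad_f1 f x1 x2 x3 x4) \<and>
     block_lipschitz (cball 0 R \<times> cball 0 R \<times> cball 0 R) Lf2
       (\<lambda>(x1, x3, x4) x2. grad_f2 f x1 x2 x3 x4) \<and>
     block_lipschitz (cball 0 R \<times> cball 0 R \<times> cball 0 R) Lf3
       (\<lambda>(x1, x2, x4) x3. grad_f3 f x1 x2 x3 x4) \<and>
     block_lipschitz (cball 0 R \<times> cball 0 R \<times> cball 0 R) Lf4
       (\<lambda>(x1, x2, x3) x4. grad_f4 f x1 x2 x3 x4) \<and>
     block_lipschitz (cball 0 R) Lg1 (\<lambda>x2 x1. grad_g1 g x1 x2) \<and>
     block_lipschitz (cball 0 R) Lg2 (\<lambda>x1 x2. grad_g2 g x1 x2) \<and>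
     multiconvex_f f \<and> multiconvex_g g"


section \<open>The algorithm\<close>

definition qnorm :: "real ^ 'k ^ 'k \<Rightarrow> real ^ 'k \<Rightarrow> real" where
  "qnorm P x = inner x (P *v x)"

text \<open>Diagonal, with a positive multiple of the identity as block of each vertex.\<close>

definition vertex_scaling :: "real ^ ('n::finite \<times> 'd::finite) ^ ('n \<times> 'd) \<Rightarrow> bool" where
  "vertex_scaling H \<longleftrightarrow>
     (\<exists>h. (\<forall>v. 0 < h v) \<and> H = (\<chi> i j. if i = j then h (fst i) else 0))"

definition pradmm ::
  "'n::finite vec4 set \<Rightarrow> ('n point \<Rightarrow> real) \<Rightarrow> ('n vec4 \<times> 'n vec4 \<Rightarrow> real) \<Rightarrow> real \<Rightarrow> real \<Rightarrow>
   real ^ ('n \<times> 4) ^ ('n \<times> 4) \<Rightarrow> real ^ ('n \<times> 4) ^ ('n \<times> 4) \<Rightarrow>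
   real ^ ('n \<times> 3) ^ ('n \<times> 3) \<Rightarrow> real ^ ('n \<times> 3) ^ ('n \<times> 3) \<Rightarrow>
   (nat \<Rightarrow> 'n vec4) \<Rightarrow> (nat \<Rightarrow> 'n vec4) \<Rightarrow> (nat \<Rightarrow> 'n vec3) \<Rightarrow> (nat \<Rightarrow> 'n vec3) \<Rightarrow>
   (nat \<Rightarrow> 'n dual) \<Rightarrow> bool" where
  "pradmm M f g \<beta> \<tau> H1 H2 H3 H4 x1 x2 x3 x4 lam \<longleftrightarrow> (\<forall>k.
     is_arg_min (\<lambda>y. auglag f g \<beta> y (x2 k) (x3 k) (x4 k) (lam k) + 1/2 * qnorm H1 (y - x1 k))
       (\<lambda>y. y \<in> M) (x1 (Suc k)) \<and>
     is_arg_min (\<lambda>y. auglag f g \<beta> (x1 (Suc k)) y (x3 k) (x4 k) (lam k) + 1/2 * qnorm H2 (y - x2 k))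
       (\<lambda>y. True) (x2 (Suc k)) \<and>
     is_arg_min (\<lambda>y. auglag f g \<beta> (x1 (Suc k)) (x2 (Suc k)) y (x4 k) (lam k)
         + 1/2 * qnorm H3 (y - x3 k))
       (\<lambda>y. True) (x3 (Suc k)) \<and>
     is_arg_min (\<lambda>y. auglag f g \<beta> (x1 (Suc k)) (x2 (Suc k)) (x3 (Suc k)) y (lam k)
         + 1/2 * qnorm H4 (y - x4 k))
       (\<lambda>y. True) (x4 (Suc k)) \<and>
     lam (Suc k) = lam k
       - (\<tau> * \<beta>) *\<^sub>R residual (x1 (Suc k)) (x2 (Suc k)) (x3 (Suc k)) (x4 (Suc k)))"


section \<open>Lyapunov function and stationarity\<close>

definition \<alpha>1 :: "real \<Rightarrow> real" where
  "\<alpha>1 \<tau> = \<bar>1 - \<tau>\<bar> / (1 - \<bar>1 - \<tau>\<bar>)"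

definition \<alpha>2 :: "real \<Rightarrow> real" where
  "\<alpha>2 \<tau> = \<tau> / (1 - \<bar>1 - \<tau>\<bar>)\<^sup>2"

definition M1 :: "real \<Rightarrow> real \<Rightarrow> real \<Rightarrow> real \<Rightarrow> real ^ 'k ^ 'k \<Rightarrow> real ^ 'k ^ 'k" where
  "M1 \<tau> \<beta> Lf Lg H1 = (1/2) *\<^sub>R H1 - (\<alpha>2 \<tau> / \<beta> * (7 * Lf\<^sup>2 + 4 * Lg\<^sup>2)) *\<^sub>R mat 1"

definition M2 :: "real \<Rightarrow> real \<Rightarrow> real \<Rightarrow> real \<Rightarrow> real ^ 'k ^ 'k \<Rightarrow> real ^ 'k ^ 'k" where
  "M2 \<tau> \<beta> Lf Lg H2 = H2 - (\<alpha>2 \<tau> / \<beta>) *\<^sub>R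
     ((7 * Lf\<^sup>2) *\<^sub>R mat 1 + (4 * Lg\<^sup>2) *\<^sub>R mat 1 + 4 *\<^sub>R (transpose H2 ** H2))"

definition M3 :: "real \<Rightarrow> real \<Rightarrow> real \<Rightarrow> real ^ 'k ^ 'k \<Rightarrow> real ^ 'k ^ 'k" where
  "M3 \<tau> \<beta> Lf H3 = H3 - (3 * \<alpha>2 \<tau> / \<beta> * Lf\<^sup>2) *\<^sub>R mat 1"

definition M4 :: "real \<Rightarrow> real \<Rightarrow> real \<Rightarrow> real ^ 'k ^ 'k \<Rightarrow> real ^ 'k ^ 'k" where
  "M4 \<tau> \<beta> Lf H4 = H4 - (\<alpha>2 \<tau> / \<beta>) *\<^sub>R
     ((3 * Lf\<^sup>2) *\<^sub>R mat 1 + 3 *\<^sub>R (transpose H4 ** H4))"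

text \<open>Backward difference; only meaningful for \<open>k \<ge> 1\<close> because of truncated subtraction.\<close>

definition diff_seq :: "(nat \<Rightarrow> 'a::ab_group_add) \<Rightarrow> nat \<Rightarrow> 'a" where
  "diff_seq x k = x k - x (k - 1)"

definition lyapunov ::
  "('n::finite point \<Rightarrow> real) \<Rightarrow> ('n vec4 \<times> 'n vec4 \<Rightarrow> real) \<Rightarrow> real \<Rightarrow> real \<Rightarrow> real \<Rightarrow> real \<Rightarrow>
   real ^ ('n \<times> 4) ^ ('n \<times> 4) \<Rightarrow> real ^ ('n \<times> 4) ^ ('n \<times> 4) \<Rightarrow>
   real ^ ('n \<times> 3) ^ ('n \<times> 3) \<Rightarrow> real ^ ('n \<times> 3) ^ ('n \<times> 3) \<Rightarrow>
   (nat \<Rightarrow> 'n vec4) \<Rightarrow> (nat \<Rightarrow> 'n vec4) \<Rightarrow> (nat \<Rightarrow> 'n vec3) \<Rightarrow> (nat \<Rightarrow> 'n vec3) \<Rightarrow>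
   (nat \<Rightarrow> 'n dual) \<Rightarrow> nat \<Rightarrow> real" where
  "lyapunov f g \<beta> \<tau> Lf Lg H1 H2 H3 H4 x1 x2 x3 x4 lam k =
     auglag f g \<beta> (x1 k) (x2 k) (x3 k) (x4 k) (lam k)
       + \<alpha>1 \<tau> / (\<tau> * \<beta>) * (norm (diff_seq lam k))\<^sup>2
       + qnorm (M1 \<tau> \<beta> Lf Lg H1) (diff_seq x1 k) + qnorm (M2 \<tau> \<beta> Lf Lg H2) (diff_seq x2 k)
       + qnorm (M3 \<tau> \<beta> Lf H3) (diff_seq x3 k) + qnorm (M4 \<tau> \<beta> Lf H4) (diff_seq x4 k)"

definition stationary ::
  "'n::finite vec4 set \<Rightarrow> ('n point \<Rightarrow> real) \<Rightarrow> ('n vec4 \<times> 'n vec4 \<Rightarrow> real) \<Rightarrow>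
   'n vec4 \<Rightarrow> 'n vec4 \<Rightarrow> 'n vec3 \<Rightarrow> 'n vec3 \<Rightarrow> 'n dual \<Rightarrow> bool" where
  "stationary M f g x1 x2 x3 x4 lam \<longleftrightarrow>
     x1 \<in> M \<and> residual x1 x2 x3 x4 = 0 \<and>
     orth_proj (tangent_space M x1)
       (grad_f1 f x1 x2 x3 x4 + grad_g1 g x1 x2 - transpose A1 *v lam) = 0 \<and>
     grad_f2 f x1 x2 x3 x4 + grad_g2 g x1 x2 - transpose A2 *v lam = 0 \<and>
     grad_f3 f x1 x2 x3 x4 - transpose A3 *v lam = 0 \<and>
     grad_f4 f x1 x2 x3 x4 - transpose A4 *v lam = 0"

definition seq_limit_point :: "(nat \<Rightarrow> 'a::topological_space) \<Rightarrow> 'a \<Rightarrow> bool" where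
  "seq_limit_point s a \<longleftrightarrow> (\<exists>r. strict_mono r \<and> (s \<circ> r) \<longlonglongrightarrow> a)"

end

theory Submission
  imports Defs
begin

text \<open>The optimality conditions of blocks 2 and 4 express the relaxed multiplier
  \<open>lam k + (lam (k+1) - lam k) / \<tau>\<close> through gradients of \<open>f\<close>, \<open>g\<close> and proximal terms. Hence the
  multiplier increments satisfy a recursion with factor \<open>1 - \<tau>\<close>, driven by differences of these
  gradients, and by the Lipschitz bounds the dual ascent in the augmented Lagrangian is \<open>O(1/\<beta>)\<close>
  times squared primal increments, up to a telescoping term. The proximal descent of the four block
  steps (doubled for the convex blocks 2 to 4) absorbs it for large \<open>\<beta>\<close>, with all \<open>\<delta>\<close> equal to
  \<open>1/2\<close>.\<close>

section \<open>Gradients and first-order conditions\<close>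

text \<open>The obstacle is a time lag. Block 2 is solved while blocks 3 and 4 still hold their old
  values, and proximal terms sit in the conditions of blocks 2 and 4; so the difference of two
  consecutive optimality conditions contains primal increments of two successive sweeps. The
  increments of the newer sweep are paid by the descent of that sweep, and what this costs is
  exactly what is subtracted from the proximal matrices in \<open>M1\<close> to \<open>M4\<close>.
  The increments of the older sweep are already stored in the Lyapunov function through these
  reduced metrics, and half of each metric suffices to pay for them when \<beta> is large. Only
  block 1 has a nonconvex domain. There, comparison with the previous iterate is all that is
  available, which explains the factor 1/2 in front of \<open>H1\<close>. Decrease alone does not
  make increments vanish: boundedness of the multipliers also keeps the augmented Lagrangian bounded
  below, by completing a square.\<close>

lemma GDERIV_unique:
  assumes "GDERIV F x :> D" "GDERIV F x :> D'"
  shows "D = D'"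
proof -
  have "(\<lambda>h. inner h D) = (\<lambda>h. inner h D')"
    using assms has_derivative_unique unfolding gderiv_def by blast
  then have "inner (D - D') D = inner (D - D') D'"
    by metis
  then have "inner (D - D') (D - D') = 0"
    by (simp add: inner_diff_right)
  then show ?thesis
    by simp
qed

lemma grad_eqI: "GDERIV F x :> D \<Longrightarrow> grad F x = D"
  unfolding grad_def using GDERIV_unique by blast

lemma GDERIV_grad:
  fixes F :: "'a::euclidean_space \<Rightarrow> real"
  assumes "F differentiable at x"
  shows "GDERIV F x :> grad F x"
proof -
  obtain F' where F': "(F has_derivative F') (at x)"
    using assms unfolding differentiable_def by blast
  then have "linear F'"
    using has_derivative_linear by blast
  \<comment> \<open>The derivative is a linear functional on a Euclidean space; its adjoint at 1 is
    the vector representing it.\<close>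
  then have "F' = (\<lambda>h. inner h (adjoint F' 1))"
    by (simp add: adjoint_works fun_eq_iff)
  then have "GDERIV F x :> adjoint F' 1"
    using F' unfolding gderiv_def by simp
  then show ?thesis
    using grad_eqI by metis
qed

lemma GDERIV_compose_affine:
  assumes F: "GDERIV F (j p) :> D" and j: "(j has_derivative J) (at p)"
    and D': "\<And>h. inner (J h) D = inner h D'"
  shows "GDERIV (\<lambda>y. F (j y)) p :> D'"
  using has_derivative_compose[OF j F[unfolded gderiv_def]] unfolding gderiv_def D' .

text \<open>The last claim matters for the estimates: since the full gradient is the tuple of the
  partial ones, the Lipschitz constant of \<open>grad f\<close> passes to each block.\<close>

lemma GDERIV_blocks4:
  fixes f :: "'n::finite point \<Rightarrow> real"
  assumes "f differentiable at (x1, x2, x3, x4)"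
  shows "GDERIV (\<lambda>y. f (y, x2, x3, x4)) x1 :> grad_f1 f x1 x2 x3 x4"
    and "GDERIV (\<lambda>y. f (x1, y, x3, x4)) x2 :> grad_f2 f x1 x2 x3 x4"
    and "GDERIV (\<lambda>y. f (x1, x2, y, x4)) x3 :> grad_f3 f x1 x2 x3 x4"
    and "GDERIV (\<lambda>y. f (x1, x2, x3, y)) x4 :> grad_f4 f x1 x2 x3 x4"
    and "grad f (x1, x2, x3, x4) =
      (grad_f1 f x1 x2 x3 x4, grad_f2 f x1 x2 x3 x4, grad_f3 f x1 x2 x3 x4, grad_f4 f x1 x2 x3 x4)"
proof -
  obtain d1 d2 d3 d4 where d: "grad f (x1, x2, x3, x4) = (d1, d2, d3, d4)"
    by (metis prod.exhaust)
  have G: "GDERIV f (x1, x2, x3, x4) :> (d1, d2, d3, d4)"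
    using GDERIV_grad[OF assms] d by simp
  have 1: "GDERIV (\<lambda>y. f (y, x2, x3, x4)) x1 :> d1"
    by (rule GDERIV_compose_affine[where j = "\<lambda>y. (y, x2, x3, x4)" and J = "\<lambda>h. (h, 0, 0, 0)", OF G])
      (auto intro!: derivative_eq_intros simp: zero_prod_def)
  have 2: "GDERIV (\<lambda>y. f (x1, y, x3, x4)) x2 :> d2"
    by (rule GDERIV_compose_affine[where j = "\<lambda>y. (x1, y, x3, x4)" and J = "\<lambda>h. (0, h, 0, 0)", OF G])
      (auto intro!: derivative_eq_intros simp: zero_prod_def)
  have 3: "GDERIV (\<lambda>y. f (x1, x2, y, x4)) x3 :> d3"
    by (rule GDERIV_compose_affine[where j = "\<lambda>y. (x1, x2, y, x4)" and J = "\<lambda>h. (0, 0, h, 0)", OF G])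
      (auto intro!: derivative_eq_intros simp: zero_prod_def)
  have 4: "GDERIV (\<lambda>y. f (x1, x2, x3, y)) x4 :> d4"
    by (rule GDERIV_compose_affine[where j = "\<lambda>y. (x1, x2, x3, y)" and J = "\<lambda>h. (0, 0, 0, h)", OF G])
      (auto intro!: derivative_eq_intros simp: zero_prod_def)
  have e: "grad_f1 f x1 x2 x3 x4 = d1" "grad_f2 f x1 x2 x3 x4 = d2"
    "grad_f3 f x1 x2 x3 x4 = d3" "grad_f4 f x1 x2 x3 x4 = d4"
    unfolding grad_f1_def grad_f2_def grad_f3_def grad_f4_def using 1 2 3 4 grad_eqI by blast+
  show "GDERIV (\<lambda>y. f (y, x2, x3, x4)) x1 :> grad_f1 f x1 x2 x3 x4"
    "GDERIV (\<lambda>y. f (x1, y, x3, x4)) x2 :> grad_f2 f x1 x2 x3 x4"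
    "GDERIV (\<lambda>y. f (x1, x2, y, x4)) x3 :> grad_f3 f x1 x2 x3 x4"
    "GDERIV (\<lambda>y. f (x1, x2, x3, y)) x4 :> grad_f4 f x1 x2 x3 x4"
    "grad f (x1, x2, x3, x4) =
      (grad_f1 f x1 x2 x3 x4, grad_f2 f x1 x2 x3 x4, grad_f3 f x1 x2 x3 x4, grad_f4 f x1 x2 x3 x4)"
    unfolding e using 1 2 3 4 d by blast+
qed

lemma GDERIV_blocks2:
  fixes g :: "'n::finite vec4 \<times> 'n vec4 \<Rightarrow> real"
  assumes "g differentiable at (x1, x2)"
  shows "GDERIV (\<lambda>y. g (y, x2)) x1 :> grad_g1 g x1 x2"
    and "GDERIV (\<lambda>y. g (x1, y)) x2 :> grad_g2 g x1 x2"
    and "grad g (x1, x2) = (grad_g1 g x1 x2, grad_g2 g x1 x2)"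
proof -
  obtain d1 d2 where d: "grad g (x1, x2) = (d1, d2)"
    by fastforce
  have G: "GDERIV g (x1, x2) :> (d1, d2)"
    using GDERIV_grad[OF assms] d by simp
  have 1: "GDERIV (\<lambda>y. g (y, x2)) x1 :> d1"
    by (rule GDERIV_compose_affine[where j = "\<lambda>y. (y, x2)" and J = "\<lambda>h. (h, 0)", OF G])
      (auto intro!: derivative_eq_intros simp: zero_prod_def)
  have 2: "GDERIV (\<lambda>y. g (x1, y)) x2 :> d2"
    by (rule GDERIV_compose_affine[where j = "\<lambda>y. (x1, y)" and J = "\<lambda>h. (0, h)", OF G])
      (auto intro!: derivative_eq_intros simp: zero_prod_def)
  have e: "grad_g1 g x1 x2 = d1" "grad_g2 g x1 x2 = d2"
    unfolding grad_g1_def grad_g2_def using 1 2 grad_eqI by blast+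
  show "GDERIV (\<lambda>y. g (y, x2)) x1 :> grad_g1 g x1 x2"
    "GDERIV (\<lambda>y. g (x1, y)) x2 :> grad_g2 g x1 x2"
    "grad g (x1, x2) = (grad_g1 g x1 x2, grad_g2 g x1 x2)"
    unfolding e using 1 2 d by blast+
qed

lemma GDERIV_qnorm:
  fixes H :: "real ^ 'k::finite ^ 'k"
  assumes "transpose H = H"
  shows "GDERIV (\<lambda>y. 1/2 * qnorm H (y - c)) p :> H *v (p - c)"
proof -
  have sym: "inner a (H *v b) = inner b (H *v a)" for a b
    by (metis assms dot_lmul_matrix inner_commute transpose_matrix_vector)
  have "((\<lambda>y. H *v (y - c)) has_derivative (\<lambda>h. H *v h)) (at p)"
    by (rule bounded_linear.has_derivative[OF matrix_vector_mul_bounded_linear])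
      (auto intro!: derivative_eq_intros)
  then show ?thesis
    unfolding gderiv_def qnorm_def
    by (auto intro!: derivative_eq_intros simp: sym)
qed

lemma GDERIV_penalty:
  fixes A :: "real ^ 'k::finite ^ 'm::finite"
  assumes "GDERIV \<phi> p :> D"
  shows "GDERIV (\<lambda>y. \<phi> y - inner lam (A *v y + b) + \<beta> / 2 * (norm (A *v y + b))\<^sup>2) p
    :> D - transpose A *v (lam - \<beta> *\<^sub>R (A *v p + b))"
proof -
  have tr: "inner h (w v* A) = inner w (A *v h)" for h w
    by (metis dot_lmul_matrix inner_commute)
  have 1: "((\<lambda>y. A *v y) has_derivative (\<lambda>h. A *v h)) (at p)"
    by (rule bounded_linear_imp_has_derivative[OF matrix_vector_mul_bounded_linear])
  have 2: "((\<lambda>y. A *v y + b) has_derivative (\<lambda>h. A *v h)) (at p)"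
    using has_derivative_add_const[OF 1] .
  have "((\<lambda>y. \<phi> y - inner lam (A *v y + b) + \<beta> / 2 * inner (A *v y + b) (A *v y + b))
      has_derivative (\<lambda>h. inner h D - inner lam (A *v h)
        + \<beta> / 2 * (inner (A *v p + b) (A *v h) + inner (A *v h) (A *v p + b)))) (at p)"
    by (intro has_derivative_add has_derivative_diff has_derivative_inner_right
        has_derivative_mult_right has_derivative_inner 2 assms[unfolded gderiv_def])
  moreover have "inner h D - inner lam (A *v h)
        + \<beta> / 2 * (inner (A *v p + b) (A *v h) + inner (A *v h) (A *v p + b))
      = inner h (D - transpose A *v (lam - \<beta> *\<^sub>R (A *v p + b)))" for h
    by (simp add: inner_diff_right inner_diff_left tr inner_commute[of "A *v h" "A *v p + b"])
  ultimately show ?thesis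
    unfolding gderiv_def power2_norm_eq_inner by simp
qed

lemma GDERIV_proximal:
  fixes A :: "real ^ 'k::finite ^ 'm::finite"
  assumes "GDERIV \<phi> p :> D" "transpose H = H"
  shows "GDERIV (\<lambda>y. \<phi> y - inner lam (A *v y + b) + \<beta> / 2 * (norm (A *v y + b))\<^sup>2 + 1/2 * qnorm H (y - c)) p
    :> D - transpose A *v (lam - \<beta> *\<^sub>R (A *v p + b)) + H *v (p - c)"
  by (intro GDERIV_add GDERIV_penalty GDERIV_qnorm assms)

section \<open>First-order conditions at minimizers, free and along the manifold\<close>

lemma GDERIV_min_zero:
  assumes "GDERIV F p :> D" "\<And>y. F p \<le> F y"
  shows "D = 0"
proof -
  have "(\<lambda>h. inner h D) = (\<lambda>h. 0)"
    by (rule has_derivative_local_min) (use assms in \<open>auto simp: gderiv_def\<close>)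
  then show ?thesis
    by (metis inner_eq_zero_iff)
qed

text \<open>Along a curve in \<open>M\<close> through \<open>p\<close>, the function
  \<open>F\<close> has a local minimum at parameter 0, so Fermat's rule in one real variable
  applies; the chain rule identifies the derivative as \<open>inner v D\<close>.\<close>

lemma tangent_first_order:
  assumes F: "GDERIV F p :> D" and min: "\<And>y. y \<in> M \<Longrightarrow> F p \<le> F y"
    and v: "v \<in> tangent_space M p"
  shows "inner v D = 0"
proof -
  obtain \<gamma> e where e: "0 < e" and \<gamma>: "\<gamma> 0 = p" "\<And>t. t \<in> {-e<..<e} \<Longrightarrow> \<gamma> t \<in> M"
    and d: "(\<gamma> has_vector_derivative v) (at 0)"
    using v unfolding tangent_space_def by auto
  have "((\<lambda>t. F (\<gamma> t)) has_derivative (\<lambda>t. inner (t *\<^sub>R v) D)) (at 0)"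
    using has_derivative_compose[OF d[unfolded has_vector_derivative_def]] F \<gamma>(1)
    unfolding gderiv_def by blast
  then have "DERIV (\<lambda>t. F (\<gamma> t)) 0 :> inner v D"
    by (simp add: has_field_derivative_def mult_commute_abs)
  then show ?thesis
    by (rule DERIV_local_min[OF _ e]) (simp add: \<gamma> min abs_less_iff)
qed

lemma smooth_on_const: "smooth_on (\<lambda>_. c) U"
proof -
  have "C_order_on k (\<lambda>_::'a. c) U" for k and c :: 'b
    by (induction k arbitrary: c) (auto simp: frechet_derivative_const)
  then show ?thesis
    unfolding smooth_on_def by blast
qed

lemma zero_in_tangent_space:
  assumes "p \<in> M"
  shows "0 \<in> tangent_space M p"
  unfolding tangent_space_def
  using assms smooth_on_const by (auto intro!: exI[of _ "\<lambda>_. p"] exI[of _ "1::real"])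

text \<open>As \<open>orth_proj\<close> is a definite description, uniqueness has to be shown too: a
  candidate \<open>u\<close> lies in \<open>S\<close>, so it is orthogonal to \<open>w\<close> and
  to \<open>w - u\<close>, hence to itself.\<close>

lemma orth_proj_eq_0:
  assumes "0 \<in> S" "\<And>v. v \<in> S \<Longrightarrow> inner v w = 0"
  shows "orth_proj S w = 0"
  unfolding orth_proj_def
proof (rule the_equality)
  show "0 \<in> S \<and> (\<forall>v\<in>S. inner (w - 0) v = 0)"
    using assms by (simp add: inner_commute)
  fix u assume u: "u \<in> S \<and> (\<forall>v\<in>S. inner (w - u) v = 0)"
  then have "inner w u = 0" "inner (w - u) u = 0"
    using assms(2)[of u] by (auto simp: inner_commute)
  then show "u = 0"
    by (simp add: inner_diff_left)
qed

text \<open>The proximal term is gained twice: once from minimality, once from strong convexity.\<close>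

lemma block_descent:
  fixes A :: "real ^ 'k::finite ^ 'm::finite"
  assumes D: "GDERIV \<phi> p :> D" and H: "transpose H = H"
    and conv: "\<phi> c \<ge> \<phi> p + inner D (c - p)"
    and S: "\<And>y. S y = \<phi> y - inner lam (A *v y + b) + \<beta> / 2 * (norm (A *v y + b))\<^sup>2"
    and \<beta>: "0 \<le> \<beta>"
    and min: "\<And>y. S p + 1/2 * qnorm H (p - c) \<le> S y + 1/2 * qnorm H (y - c)"
  shows "S p + qnorm H (p - c) \<le> S c"
    and "D + H *v (p - c) = transpose A *v (lam - \<beta> *\<^sub>R (A *v p + b))"
proof -
  let ?r = "A *v p + b" and ?s = "A *v c + b"
  have opt: "D - transpose A *v (lam - \<beta> *\<^sub>R ?r) + H *v (p - c) = 0"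
    by (rule GDERIV_min_zero[OF GDERIV_proximal[OF D H]]) (use min S in simp)
  then show eq: "D + H *v (p - c) = transpose A *v (lam - \<beta> *\<^sub>R ?r)"
    by (simp add: algebra_simps)
  \<comment> \<open>By \<open>eq\<close>, the gradient of \<open>S\<close> at \<open>p\<close> is
    \<open>- (H *v (p - c))\<close>. Convexity of \<open>S\<close>, tested in the direction
    \<open>c - p\<close>, therefore yields the whole of \<open>qnorm H (p - c)\<close> instead of
    half of it.\<close>
  have "inner (D + H *v (p - c)) (c - p) = inner (lam - \<beta> *\<^sub>R ?r) (?s - ?r)"
    unfolding eq transpose_matrix_vector dot_lmul_matrix
    by (simp add: matrix_vector_mult_diff_distrib)
  moreover have "inner (H *v (p - c)) (c - p) = - qnorm H (p - c)"
    unfolding qnorm_def by (metis inner_commute inner_minus_right minus_diff_eq)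
  moreover have "(norm ?s)\<^sup>2 \<ge> (norm ?r)\<^sup>2 + 2 * inner ?r (?s - ?r)"
  proof -
    have "0 \<le> inner (?s - ?r) (?s - ?r)" by simp
    then show ?thesis
      unfolding power2_norm_eq_inner inner_diff_left inner_diff_right
      by (simp add: inner_commute)
  qed
  then have "\<beta> / 2 * ((norm ?s)\<^sup>2 - (norm ?r)\<^sup>2 - 2 * inner ?r (?s - ?r)) \<ge> 0"
    using \<beta> by simp
  ultimately show "S p + qnorm H (p - c) \<le> S c"
    using conv unfolding S by (simp add: inner_add_left inner_diff_left inner_diff_right algebra_simps)
qed

section \<open>Matrices and norms\<close>

lemma transpose_mult_A_nth:
  fixes w :: "'n::finite dual"
  shows "(w v* A1) $ c = w $ Inl c" "(w v* A2) $ c = - w $ Inl c"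
    "(w v* A3) $ d = w $ Inr d" "(w v* A4) $ d = - w $ Inr d"
proof -
  have UNIV_sum: "(\<Sum>r\<in>UNIV. h r) = (\<Sum>i\<in>UNIV. h (Inl i)) + (\<Sum>j\<in>UNIV. h (Inr j))"
    for h :: "'a::finite + 'b::finite \<Rightarrow> real"
    by (simp flip: UNIV_Plus_UNIV add: sum.Plus)
  have delta: "(\<Sum>i\<in>UNIV. v i * (if i = c then s else 0)) = v c * s"
    for c :: "'k::finite" and s :: real and v
    by (subst sum.cong[OF refl, where h = "\<lambda>i. if i = c then v c * s else 0"]) auto
  show "(w v* A1) $ c = w $ Inl c" "(w v* A2) $ c = - w $ Inl c"
    "(w v* A3) $ d = w $ Inr d" "(w v* A4) $ d = - w $ Inr d"
    by (simp_all add: vector_matrix_mult_def A1_def A2_def A3_def A4_def UNIV_sum delta)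
qed

lemma residual_transpose:
  "residual x1 x2 x3 x4 v* A2 = x2 - x1" "residual x1 x2 x3 x4 v* A4 = x4 - x3"
  by (simp_all add: vec_eq_iff transpose_mult_A_nth residual_nth)

text \<open>Measures a multiplier by the two parts that enter the optimality conditions of blocks 2
  and 4, which is where its increments can be controlled.\<close>

lemma norm_dual_split:
  fixes w :: "'n::finite dual"
  shows "(norm w)\<^sup>2 = (norm (w v* A2))\<^sup>2 + (norm (w v* A4))\<^sup>2"
  unfolding power2_norm_eq_inner inner_vec_def
  by (simp flip: UNIV_Plus_UNIV add: sum.Plus transpose_mult_A_nth)

text \<open>Convexity of the square with weights \<open>\<bar>a\<bar>\<close> and
  \<open>1 - \<bar>a\<bar>\<close>. These weights keep the coefficient of the first square below 1,
  so a recursion built on the lemma contracts; the price is the denominator at the second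
  one.\<close>

lemma norm_sq_affine:
  fixes x y :: "'a::real_normed_vector"
  assumes "\<bar>a\<bar> < 1" "0 \<le> t"
  shows "(norm (a *\<^sub>R x + t *\<^sub>R y))\<^sup>2 \<le> \<bar>a\<bar> * (norm x)\<^sup>2 + t\<^sup>2 / (1 - \<bar>a\<bar>) * (norm y)\<^sup>2"
proof -
  define c u where "c = \<bar>a\<bar>" and "u = t * norm y / (1 - c)"
  have c: "0 \<le> c" "c < 1"
    using assms by (auto simp: c_def)
  have "norm (a *\<^sub>R x + t *\<^sub>R y) \<le> c * norm x + (1 - c) * u"
    using norm_triangle_ineq[of "a *\<^sub>R x" "t *\<^sub>R y"] assms c by (simp add: c_def u_def)
  then have "(norm (a *\<^sub>R x + t *\<^sub>R y))\<^sup>2 \<le> (c * norm x + (1 - c) * u)\<^sup>2"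
    by (simp add: power_mono)
  also have "\<dots> = c * (norm x)\<^sup>2 + (1 - c) * u\<^sup>2 - c * (1 - c) * (norm x - u)\<^sup>2"
    by (simp add: power2_eq_square algebra_simps)
  \<comment> \<open>The dropped term is the exact gap in the convexity inequality.\<close>
  also have "\<dots> \<le> c * (norm x)\<^sup>2 + (1 - c) * u\<^sup>2"
    using c by simp
  also have "(1 - c) * u\<^sup>2 = t\<^sup>2 / (1 - c) * (norm y)\<^sup>2"
    using c by (simp add: u_def power2_eq_square divide_simps)
  finally show ?thesis
    by (simp add: c_def)
qed

text \<open>Increments of \<open>G2\<close> have four summands and those of \<open>G4\<close> have
  three. The factors 4 and 3 of this lemma and the next add up to the 7 in front of
  \<open>Lf\<^sup>2\<close> in \<open>M1\<close> and \<open>M2\<close>.\<close>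

lemma norm_sq_add4_le:
  fixes a b c d :: "'a::real_inner"
  shows "(norm (a + b + c - d))\<^sup>2 \<le> 4 * ((norm a)\<^sup>2 + (norm b)\<^sup>2 + (norm c)\<^sup>2 + (norm d)\<^sup>2)"
proof -
  have two: "(norm (x + y))\<^sup>2 \<le> 2 * ((norm x)\<^sup>2 + (norm y)\<^sup>2)" for x y :: 'a
    using zero_le_power2[of "norm (x - y)"]
    by (simp add: power2_norm_eq_inner inner_add_left inner_add_right inner_diff_left
        inner_diff_right inner_commute)
  show ?thesis
    using two[of "a + b" "c - d"] two[of a b] two[of c "- d"] by (simp add: add_diff_eq)
qed

lemma norm_sq_add3_le:
  fixes a b c :: "'a::real_inner"
  shows "(norm (a + b - c))\<^sup>2 \<le> 3 * ((norm a)\<^sup>2 + (norm b)\<^sup>2 + (norm c)\<^sup>2)"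
proof -
  \<comment> \<open>The three squares sum to exactly the difference of the two sides.\<close>
  have "0 \<le> (norm (a - b))\<^sup>2 + (norm (b + c))\<^sup>2 + (norm (a + c))\<^sup>2"
    by simp
  then show ?thesis
    by (simp add: power2_norm_eq_inner inner_add_left inner_add_right inner_diff_left
        inner_diff_right inner_commute)
qed

lemma vertex_scaling_symmetric:
  "vertex_scaling H \<Longrightarrow> transpose H = H"
  unfolding vertex_scaling_def by (auto simp: transpose_def vec_eq_iff)

lemma vertex_scaling_coercive:
  assumes "vertex_scaling H"
  shows "\<exists>h>0. \<forall>x. h * (norm x)\<^sup>2 \<le> qnorm H x"
proof -
  obtain s where s: "\<And>v. 0 < s v" and H: "H = (\<chi> i j. if i = j then s (fst i) else 0)"
    using assms unfolding vertex_scaling_def by blast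
  have Hx: "(H *v x) $ i = s (fst i) * x $ i" for x i
  proof -
    have "(H *v x) $ i = (\<Sum>j\<in>UNIV. if i = j then s (fst i) * x $ i else 0)"
      unfolding matrix_vector_mult_def H vec_lambda_beta by (intro sum.cong) auto
    then show ?thesis by simp
  qed
  define h where "h = Min (range s)"
  have "h * (norm x)\<^sup>2 \<le> qnorm H x" for x
  proof -
    have "h * (x $ i * x $ i) \<le> x $ i * (s (fst i) * x $ i)" for i
    proof -
      have "h * (x $ i * x $ i) \<le> s (fst i) * (x $ i * x $ i)"
        unfolding h_def by (intro mult_right_mono Min_le) auto
      then show ?thesis by (simp add: mult_ac)
    qed
    then show ?thesis
      unfolding qnorm_def power2_norm_eq_inner inner_vec_def
      by (simp add: Hx sum_distrib_left sum_mono)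
  qed
  moreover have "h > 0"
    unfolding h_def using s by simp
  ultimately show ?thesis
    by blast
qed

lemma matrix_norm_sq_bound:
  fixes H :: "real ^ 'k::finite ^ 'm::finite"
  shows "\<exists>C\<ge>0. \<forall>x. (norm (H *v x))\<^sup>2 \<le> C * (norm x)\<^sup>2"
proof -
  obtain K where "\<And>x. norm (H *v x) \<le> norm x * K"
    using bounded_linear.bounded[OF matrix_vector_mul_bounded_linear] by blast
  then have "(norm (H *v x))\<^sup>2 \<le> K\<^sup>2 * (norm x)\<^sup>2" for x
    by (metis mult.commute norm_ge_zero power_mono power_mult_distrib)
  then show ?thesis
    by (meson zero_le_power2)
qed

text \<open>Turns the four metrics into scalar terms grouped as in \<open>E_bound\<close>, so that
  the later comparisons are linear arithmetic.\<close>

lemma qnorm_M: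
  fixes H :: "real ^ 'k::finite ^ 'k"
  shows "qnorm (M1 \<tau> \<beta> Lf Lg H) x
      = 1/2 * qnorm H x - \<alpha>2 \<tau> / \<beta> * ((7 * Lf\<^sup>2 + 4 * Lg\<^sup>2) * (norm x)\<^sup>2)"
    and "qnorm (M2 \<tau> \<beta> Lf Lg H) x
      = qnorm H x - \<alpha>2 \<tau> / \<beta> * ((7 * Lf\<^sup>2 + 4 * Lg\<^sup>2) * (norm x)\<^sup>2 + 4 * (norm (H *v x))\<^sup>2)"
    and "qnorm (M3 \<tau> \<beta> Lf H) x = qnorm H x - \<alpha>2 \<tau> / \<beta> * (3 * Lf\<^sup>2 * (norm x)\<^sup>2)"
    and "qnorm (M4 \<tau> \<beta> Lf H) x
      = qnorm H x - \<alpha>2 \<tau> / \<beta> * (3 * Lf\<^sup>2 * (norm x)\<^sup>2 + 3 * (norm (H *v x))\<^sup>2)"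
proof -
  have HH: "inner x ((transpose H ** H) *v x) = (norm (H *v x))\<^sup>2"
    by (metis dot_lmul_matrix inner_commute matrix_vector_mul_assoc power2_norm_eq_inner
        transpose_matrix_vector)
  note simps = M1_def M2_def M3_def M4_def qnorm_def matrix_vector_mult_diff_rdistrib
    matrix_vector_mult_add_rdistrib scaleR_matrix_vector_assoc[symmetric] inner_diff_right
    inner_add_right HH power2_norm_eq_inner[of x, symmetric] algebra_simps
  show "qnorm (M1 \<tau> \<beta> Lf Lg H) x
      = 1/2 * qnorm H x - \<alpha>2 \<tau> / \<beta> * ((7 * Lf\<^sup>2 + 4 * Lg\<^sup>2) * (norm x)\<^sup>2)"
    "qnorm (M2 \<tau> \<beta> Lf Lg H) x
      = qnorm H x - \<alpha>2 \<tau> / \<beta> * ((7 * Lf\<^sup>2 + 4 * Lg\<^sup>2) * (norm x)\<^sup>2 + 4 * (norm (H *v x))\<^sup>2)"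
    "qnorm (M3 \<tau> \<beta> Lf H) x = qnorm H x - \<alpha>2 \<tau> / \<beta> * (3 * Lf\<^sup>2 * (norm x)\<^sup>2)"
    "qnorm (M4 \<tau> \<beta> Lf H) x
      = qnorm H x - \<alpha>2 \<tau> / \<beta> * (3 * Lf\<^sup>2 * (norm x)\<^sup>2 + 3 * (norm (H *v x))\<^sup>2)"
    by (simp_all add: simps)
qed

lemma contraction_tendsto_0:
  fixes a b :: "nat \<Rightarrow> real"
  assumes c: "0 \<le> c" "c < 1" and a: "\<And>k. 0 \<le> a k"
    and step: "\<And>k. a (Suc k) \<le> c * a k + b k" and b: "b \<longlonglongrightarrow> 0"
  shows "a \<longlonglongrightarrow> 0"
proof (rule LIMSEQ_I)
  fix e :: real assume e: "0 < e"
  \<comment> \<open>The factor \<open>1 - c\<close> makes \<open>e / 2\<close> the fixed point of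
    the recursion with this perturbation; above it, only a geometrically decaying excess
    remains.\<close>
  obtain N where N: "\<And>k. k \<ge> N \<Longrightarrow> \<bar>b k\<bar> < e / 2 * (1 - c)"
    using LIMSEQ_D[OF b, of "e / 2 * (1 - c)"] e c by auto
  have bound: "a (N + j) \<le> c ^ j * a N + e / 2" for j
  proof (induction j)
    case (Suc j)
    have "a (N + Suc j) \<le> c * a (N + j) + b (N + j)"
      using step by simp
    also have "\<dots> \<le> c * (c ^ j * a N + e / 2) + e / 2 * (1 - c)"
      using N[of "N + j"] Suc.IH c by (intro add_mono mult_left_mono) auto
    also have "\<dots> = c ^ Suc j * a N + e / 2"
      by (simp add: field_simps)
    finally show ?case .
  qed (use e in simp)
  have "(\<lambda>j. c ^ j * a N) \<longlonglongrightarrow> 0"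
    using LIMSEQ_power_zero[of c] c tendsto_mult_left_zero by fastforce
  then obtain J where J: "\<And>j. j \<ge> J \<Longrightarrow> \<bar>c ^ j * a N\<bar> < e / 2"
    using LIMSEQ_D[of _ 0 "e / 2"] e by (metis diff_zero half_gt_zero real_norm_def)
  show "\<exists>n0. \<forall>n\<ge>n0. norm (a n - 0) < e"
  proof (intro exI[of _ "N + J"] allI impI)
    fix n assume "n \<ge> N + J"
    then show "norm (a n - 0) < e"
      using bound[of "n - N"] J[of "n - N"] a[of n] by fastforce
  qed
qed

text \<open>One sum in four bracketings, each isolating a block in the form
  \<open>A *v y + b\<close> that \<open>block_descent\<close> and \<open>GDERIV_proximal\<close>
  expect.\<close>

lemma auglag_blocks:
  "auglag f g \<beta> x1 x2 x3 x4 lam = (f (x1, x2, x3, x4) + g (x1, x2))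
    - inner lam (A1 *v x1 + (A2 *v x2 + A3 *v x3 + A4 *v x4))
    + \<beta> / 2 * (norm (A1 *v x1 + (A2 *v x2 + A3 *v x3 + A4 *v x4)))\<^sup>2"
  "auglag f g \<beta> x1 x2 x3 x4 lam = (f (x1, x2, x3, x4) + g (x1, x2))
    - inner lam (A2 *v x2 + (A1 *v x1 + A3 *v x3 + A4 *v x4))
    + \<beta> / 2 * (norm (A2 *v x2 + (A1 *v x1 + A3 *v x3 + A4 *v x4)))\<^sup>2"
  "auglag f g \<beta> x1 x2 x3 x4 lam = (f (x1, x2, x3, x4) + g (x1, x2))
    - inner lam (A3 *v x3 + (A1 *v x1 + A2 *v x2 + A4 *v x4))
    + \<beta> / 2 * (norm (A3 *v x3 + (A1 *v x1 + A2 *v x2 + A4 *v x4)))\<^sup>2"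
  "auglag f g \<beta> x1 x2 x3 x4 lam = (f (x1, x2, x3, x4) + g (x1, x2))
    - inner lam (A4 *v x4 + (A1 *v x1 + A2 *v x2 + A3 *v x3))
    + \<beta> / 2 * (norm (A4 *v x4 + (A1 *v x1 + A2 *v x2 + A3 *v x3)))\<^sup>2"
  unfolding auglag_def residual_def by (simp_all add: ac_simps)

lemma residual_blocks:
  "A1 *v x1 + (A2 *v x2 + A3 *v x3 + A4 *v x4) = residual x1 x2 x3 x4"
  "A2 *v x2 + (A1 *v x1 + A3 *v x3 + A4 *v x4) = residual x1 x2 x3 x4"
  "A3 *v x3 + (A1 *v x1 + A2 *v x2 + A4 *v x4) = residual x1 x2 x3 x4"
  "A4 *v x4 + (A1 *v x1 + A2 *v x2 + A3 *v x3) = residual x1 x2 x3 x4"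
  unfolding residual_def by (simp_all add: ac_simps)

lemma norm_sq_Pair: "(norm (a, b))\<^sup>2 = (norm a)\<^sup>2 + (norm b)\<^sup>2"
  by (simp add: norm_Pair)

lemma diff_seq_Suc [simp]: "diff_seq x (Suc k) = x (Suc k) - x k"
  by (simp add: diff_seq_def)

text \<open>Origin of \<alpha>1 and \<alpha>2: subtract \<open>c * N\<close> from both sides of the
  recursion and divide by \<open>(1 - c) * (t * b)\<close>, with
  \<open>c = \<bar>1 - \<tau>\<bar>\<close>, \<open>t = \<tau>\<close>,
  \<open>b = \<beta>\<close>.\<close>

lemma relaxation_weights:
  fixes c :: real
  assumes "0 \<le> c" "c < 1" "0 < t" "0 < b" and N: "N \<le> c * P + t\<^sup>2 / (1 - c) * E"
  shows "N / (t * b) \<le> c / (1 - c) / (t * b) * (P - N) + t / (1 - c)\<^sup>2 / b * E"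
proof -
  have "(1 - c) * N \<le> c * (P - N) + t\<^sup>2 / (1 - c) * E"
    using N by (simp add: algebra_simps)
  then have "(1 - c) * N / ((1 - c) * (t * b))
      \<le> (c * (P - N) + t\<^sup>2 / (1 - c) * E) / ((1 - c) * (t * b))"
    using assms by (intro divide_right_mono) auto
  also have "(1 - c) * N / ((1 - c) * (t * b)) = N / (t * b)"
    using assms by simp
  also have "(c * (P - N) + t\<^sup>2 / (1 - c) * E) / ((1 - c) * (t * b))
      = c / (1 - c) / (t * b) * (P - N) + t / (1 - c)\<^sup>2 / b * E"
    using assms by (simp add: add_divide_distrib power2_eq_square)
  finally show ?thesis .
qed

section \<open>Runs of the algorithm\<close>

text \<open>The parameters \<open>h\<close> and \<open>C\<close> condense the matrices into one
  coercivity constant and one growth constant, so that \<open>beta_large\<close> is a condition that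
  can be met before any problem data or run are chosen.\<close>

locale pradmm_run =
  fixes M :: "'n::finite vec4 set" and f :: "'n point \<Rightarrow> real" and g :: "'n vec4 \<times> 'n vec4 \<Rightarrow> real"
    and R Lf Lg Lf1 Lf2 Lf3 Lf4 Lg1 Lg2 \<beta> \<tau> :: real
    and H1 H2 :: "real ^ ('n \<times> 4) ^ ('n \<times> 4)" and H3 H4 :: "real ^ ('n \<times> 3) ^ ('n \<times> 3)"
    and x1 x2 :: "nat \<Rightarrow> 'n vec4" and x3 x4 :: "nat \<Rightarrow> 'n vec3" and lam :: "nat \<Rightarrow> 'n dual"
    and h C :: real
  assumes tau: "0 < \<tau>" "\<tau> < 2"
    and sym: "transpose H1 = H1" "transpose H2 = H2" "transpose H3 = H3" "transpose H4 = H4"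
    and h_pos: "0 < h"
    and coercive: "\<And>x. h * (norm x)\<^sup>2 \<le> qnorm H1 x" "\<And>x. h * (norm x)\<^sup>2 \<le> qnorm H2 x"
      "\<And>x. h * (norm x)\<^sup>2 \<le> qnorm H3 x" "\<And>x. h * (norm x)\<^sup>2 \<le> qnorm H4 x"
    and C_nonneg: "0 \<le> C"
    and H_bound: "\<And>x. (norm (H2 *v x))\<^sup>2 \<le> C * (norm x)\<^sup>2" "\<And>x. (norm (H4 *v x))\<^sup>2 \<le> C * (norm x)\<^sup>2"
    and beta_pos: "0 < \<beta>"
    and beta_large: "8 * \<alpha>2 \<tau> * (7 * Lf\<^sup>2 + 4 * Lg\<^sup>2 + 4 * C) \<le> \<beta> * h"
    and asm: "assumption_A M f g R Lf Lg Lf1 Lf2 Lf3 Lf4 Lg1 Lg2"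
    and run: "pradmm M f g \<beta> \<tau> H1 H2 H3 H4 x1 x2 x3 x4 lam"
    and bounds: "\<And>k. norm (x1 k) \<le> R" "\<And>k. norm (x2 k) \<le> R"
      "\<And>k. norm (x3 k) \<le> R" "\<And>k. norm (x4 k) \<le> R"
    and lam_bounded: "bounded (range lam)"
begin

section \<open>Block updates and their optimality conditions\<close>

lemma differentiable: "f differentiable at p" "g differentiable at q"
  using asm unfolding assumption_A_def by blast+

lemmas f_partial = GDERIV_blocks4(1-4)[OF differentiable(1)]
lemmas g_partial = GDERIV_blocks2(1-2)[OF differentiable(2)]

lemma multiconvex: "multiconvex_f f" "multiconvex_g g"
  using asm unfolding assumption_A_def by blast+

lemma argmin:
  "x1 (Suc k) \<in> M"
  "y \<in> M \<Longrightarrow> auglag f g \<beta> (x1 (Suc k)) (x2 k) (x3 k) (x4 k) (lam k) + 1/2 * qnorm H1 (x1 (Suc k) - x1 k)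
    \<le> auglag f g \<beta> y (x2 k) (x3 k) (x4 k) (lam k) + 1/2 * qnorm H1 (y - x1 k)"
  "auglag f g \<beta> (x1 (Suc k)) (x2 (Suc k)) (x3 k) (x4 k) (lam k) + 1/2 * qnorm H2 (x2 (Suc k) - x2 k)
    \<le> auglag f g \<beta> (x1 (Suc k)) y (x3 k) (x4 k) (lam k) + 1/2 * qnorm H2 (y - x2 k)"
  "auglag f g \<beta> (x1 (Suc k)) (x2 (Suc k)) (x3 (Suc k)) (x4 k) (lam k)
      + 1/2 * qnorm H3 (x3 (Suc k) - x3 k)
    \<le> auglag f g \<beta> (x1 (Suc k)) (x2 (Suc k)) z (x4 k) (lam k) + 1/2 * qnorm H3 (z - x3 k)"
  "auglag f g \<beta> (x1 (Suc k)) (x2 (Suc k)) (x3 (Suc k)) (x4 (Suc k)) (lam k)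
      + 1/2 * qnorm H4 (x4 (Suc k) - x4 k)
    \<le> auglag f g \<beta> (x1 (Suc k)) (x2 (Suc k)) (x3 (Suc k)) z (lam k) + 1/2 * qnorm H4 (z - x4 k)"
  using run unfolding pradmm_def is_arg_min_linorder by blast+

lemma multiplier_step:
  "lam (Suc k) - lam k = - ((\<tau> * \<beta>) *\<^sub>R residual (x1 (Suc k)) (x2 (Suc k)) (x3 (Suc k)) (x4 (Suc k)))"
  using run unfolding pradmm_def by simp

text \<open>The side of the optimality condition of block 2 that is free of multipliers. Blocks 3
  and 4 enter at index \<open>k\<close>, because they are updated after block 2; this is the source
  of the time lag.\<close>

definition G2 where
  "G2 k = grad_f2 f (x1 (Suc k)) (x2 (Suc k)) (x3 k) (x4 k) + grad_g2 g (x1 (Suc k)) (x2 (Suc k))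
    + H2 *v (x2 (Suc k) - x2 k)"

definition G4 where
  "G4 k = grad_f4 f (x1 (Suc k)) (x2 (Suc k)) (x3 (Suc k)) (x4 (Suc k)) + H4 *v (x4 (Suc k) - x4 k)"

lemma block2:
  "auglag f g \<beta> (x1 (Suc k)) (x2 (Suc k)) (x3 k) (x4 k) (lam k) + qnorm H2 (x2 (Suc k) - x2 k)
    \<le> auglag f g \<beta> (x1 (Suc k)) (x2 k) (x3 k) (x4 k) (lam k)"
  "G2 k = (lam k - \<beta> *\<^sub>R residual (x1 (Suc k)) (x2 (Suc k)) (x3 k) (x4 k)) v* A2"
proof -
  let ?a = "x1 (Suc k)" and ?p = "x2 (Suc k)"
  have conv: "f (?a, x2 k, x3 k, x4 k) + g (?a, x2 k) \<ge> f (?a, ?p, x3 k, x4 k) + g (?a, ?p)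
      + inner (grad_f2 f ?a ?p (x3 k) (x4 k) + grad_g2 g ?a ?p) (x2 k - ?p)"
    using multiconvex unfolding multiconvex_f_def multiconvex_g_def inner_add_left
    by (smt (verit, best))
  note bd = block_descent[OF GDERIV_add[OF f_partial(2) g_partial(2)] sym(2) conv
      auglag_blocks(2) less_imp_le[OF beta_pos] argmin(3)]
  show "auglag f g \<beta> ?a ?p (x3 k) (x4 k) (lam k) + qnorm H2 (?p - x2 k)
      \<le> auglag f g \<beta> ?a (x2 k) (x3 k) (x4 k) (lam k)"
    by (rule bd(1))
  show "G2 k = (lam k - \<beta> *\<^sub>R residual ?a ?p (x3 k) (x4 k)) v* A2"
    using bd(2) unfolding G2_def residual_blocks transpose_matrix_vector .
qed

lemma block3:
  "auglag f g \<beta> (x1 (Suc k)) (x2 (Suc k)) (x3 (Suc k)) (x4 k) (lam k) + qnorm H3 (x3 (Suc k) - x3 k)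
    \<le> auglag f g \<beta> (x1 (Suc k)) (x2 (Suc k)) (x3 k) (x4 k) (lam k)"
proof -
  let ?a = "x1 (Suc k)" and ?b = "x2 (Suc k)" and ?p = "x3 (Suc k)"
  \<comment> \<open>\<open>g\<close> is constant in this block. The summand 0 is its gradient, in
    the shape that \<open>GDERIV_add\<close> and \<open>GDERIV_const\<close> produce.\<close>
  have conv: "f (?a, ?b, x3 k, x4 k) + g (?a, ?b) \<ge> f (?a, ?b, ?p, x4 k) + g (?a, ?b)
      + inner (grad_f3 f ?a ?b ?p (x4 k) + 0) (x3 k - ?p)"
    using multiconvex(1) unfolding multiconvex_f_def by simp
  show ?thesis
    by (rule block_descent(1)[OF GDERIV_add[OF f_partial(3) GDERIV_const] sym(3) conv
        auglag_blocks(3) less_imp_le[OF beta_pos] argmin(4)])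
qed

lemma block4:
  "auglag f g \<beta> (x1 (Suc k)) (x2 (Suc k)) (x3 (Suc k)) (x4 (Suc k)) (lam k)
      + qnorm H4 (x4 (Suc k) - x4 k)
    \<le> auglag f g \<beta> (x1 (Suc k)) (x2 (Suc k)) (x3 (Suc k)) (x4 k) (lam k)"
  "G4 k = (lam k - \<beta> *\<^sub>R residual (x1 (Suc k)) (x2 (Suc k)) (x3 (Suc k)) (x4 (Suc k))) v* A4"
proof -
  let ?a = "x1 (Suc k)" and ?b = "x2 (Suc k)" and ?c = "x3 (Suc k)" and ?p = "x4 (Suc k)"
  have conv: "f (?a, ?b, ?c, x4 k) + g (?a, ?b) \<ge> f (?a, ?b, ?c, ?p) + g (?a, ?b)
      + inner (grad_f4 f ?a ?b ?c ?p + 0) (x4 k - ?p)"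
    using multiconvex(1) unfolding multiconvex_f_def by simp
  note bd = block_descent[OF GDERIV_add[OF f_partial(4) GDERIV_const] sym(4) conv
      auglag_blocks(4) less_imp_le[OF beta_pos] argmin(5)]
  show "auglag f g \<beta> ?a ?b ?c ?p (lam k) + qnorm H4 (?p - x4 k)
      \<le> auglag f g \<beta> ?a ?b ?c (x4 k) (lam k)"
    by (rule bd(1))
  show "G4 k = (lam k - \<beta> *\<^sub>R residual ?a ?b ?c ?p) v* A4"
    using bd(2) unfolding G4_def residual_blocks transpose_matrix_vector by simp
qed

text \<open>Blocks 2 and 4 see the whole multiplier, because the matrix with blocks \<open>A2\<close>, \<open>A4\<close> is
  \<open>- 1\<close>; and updating blocks 3, 4 does not change the part of the residual seen by block 2.\<close>

lemma multiplier_eq: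
  "(lam (Suc k) - lam k) v* A2 = \<tau> *\<^sub>R (G2 k - lam k v* A2)"
  "(lam (Suc k) - lam k) v* A4 = \<tau> *\<^sub>R (G4 k - lam k v* A4)"
proof -
  have lin: "(a - r *\<^sub>R b) v* A = a v* A - r *\<^sub>R (b v* A)" "(- (r *\<^sub>R b)) v* A = - (r *\<^sub>R (b v* A))"
    for a b :: "real ^ 'k::finite" and r and A :: "real ^ 'm::finite ^ 'k"
    by (simp_all flip: transpose_matrix_vector
        add: linear_diff[OF matrix_vector_mul_linear] linear_neg[OF matrix_vector_mul_linear]
          linear_cmul[OF matrix_vector_mul_linear])
  show "(lam (Suc k) - lam k) v* A2 = \<tau> *\<^sub>R (G2 k - lam k v* A2)"
    unfolding multiplier_step block2(2) lin residual_transpose by (simp add: algebra_simps)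
  show "(lam (Suc k) - lam k) v* A4 = \<tau> *\<^sub>R (G4 k - lam k v* A4)"
    unfolding multiplier_step block4(2) lin residual_transpose by (simp add: algebra_simps)
qed

section \<open>Contraction of the multiplier increments\<close>

definition E where
  "E k = (norm (G2 (Suc k) - G2 k))\<^sup>2 + (norm (G4 (Suc k) - G4 k))\<^sup>2"

lemma relaxation_factor: "\<bar>1 - \<tau>\<bar> < 1"
  using tau by auto

text \<open>Subtracting consecutive instances of \<open>multiplier_eq\<close> leaves the previous
  increment with weight \<open>1 - \<tau>\<close>, of modulus below 1 precisely for \<tau> in (0,2),
  plus \<tau> times an increment of \<open>G2\<close> or \<open>G4\<close>. The two parts are
  recombined by \<open>norm_dual_split\<close>.\<close>

lemma multiplier_contraction:
  "(norm (lam (Suc (Suc k)) - lam (Suc k)))\<^sup>2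
    \<le> \<bar>1 - \<tau>\<bar> * (norm (lam (Suc k) - lam k))\<^sup>2 + \<tau>\<^sup>2 / (1 - \<bar>1 - \<tau>\<bar>) * E k"
proof -
  have lin: "(a - b) v* A = a v* A - b v* A"
    for a b :: "real ^ 'k::finite" and A :: "real ^ 'm::finite ^ 'k"
    by (simp flip: transpose_matrix_vector add: linear_diff[OF matrix_vector_mul_linear])
  let ?d = "lam (Suc k) - lam k" and ?d' = "lam (Suc (Suc k)) - lam (Suc k)"
  have rec: "?d' v* A2 = (1 - \<tau>) *\<^sub>R (?d v* A2) + \<tau> *\<^sub>R (G2 (Suc k) - G2 k)"
    "?d' v* A4 = (1 - \<tau>) *\<^sub>R (?d v* A4) + \<tau> *\<^sub>R (G4 (Suc k) - G4 k)"
    using multiplier_eq[of k] multiplier_eq[of "Suc k"] unfolding lin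
    by (simp_all add: algebra_simps)
  show ?thesis
    unfolding norm_dual_split[of ?d'] norm_dual_split[of ?d] rec E_def
    using norm_sq_affine[OF relaxation_factor, of \<tau> "?d v* A2" "G2 (Suc k) - G2 k"]
      norm_sq_affine[OF relaxation_factor, of \<tau> "?d v* A4" "G4 (Suc k) - G4 k"] tau(1)
    by (simp add: distrib_left)
qed

text \<open>The left-hand side is what the multiplier update adds to the augmented Lagrangian. The
  difference of squares is cancelled by the \<alpha>1 term of \<open>lyapunov\<close>.\<close>

lemma multiplier_bound:
  "(norm (lam (Suc (Suc k)) - lam (Suc k)))\<^sup>2 / (\<tau> * \<beta>)
    \<le> \<alpha>1 \<tau> / (\<tau> * \<beta>) * ((norm (lam (Suc k) - lam k))\<^sup>2 - (norm (lam (Suc (Suc k)) - lam (Suc k)))\<^sup>2)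
      + \<alpha>2 \<tau> / \<beta> * E k"
  unfolding \<alpha>1_def \<alpha>2_def
  by (rule relaxation_weights[OF _ relaxation_factor tau(1) beta_pos multiplier_contraction]) simp

text \<open>The constant of the full gradient bounds the sum of the squares of all four partial
  increments, hence each of them.\<close>

lemma grad_f_lipschitz:
  assumes "norm a1 \<le> R" "norm a2 \<le> R" "norm a3 \<le> R" "norm a4 \<le> R"
    and "norm b1 \<le> R" "norm b2 \<le> R" "norm b3 \<le> R" "norm b4 \<le> R"
  defines "N \<equiv> Lf\<^sup>2 * ((norm (a1 - b1))\<^sup>2 + (norm (a2 - b2))\<^sup>2 + (norm (a3 - b3))\<^sup>2 + (norm (a4 - b4))\<^sup>2)"
  shows "(norm (grad_f2 f a1 a2 a3 a4 - grad_f2 f b1 b2 b3 b4))\<^sup>2 \<le> N"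
    and "(norm (grad_f4 f a1 a2 a3 a4 - grad_f4 f b1 b2 b3 b4))\<^sup>2 \<le> N"
proof -
  have "Lf-lipschitz_on (cball 0 R \<times> cball 0 R \<times> cball 0 R \<times> cball 0 R) (grad f)"
    using asm unfolding assumption_A_def lipschitz_on_bounded_def by blast
  then have "dist (grad f (a1, a2, a3, a4)) (grad f (b1, b2, b3, b4))
      \<le> Lf * dist (a1, a2, a3, a4) (b1, b2, b3, b4)"
    by (rule lipschitz_onD) (use assms in auto)
  then have "(dist (grad f (a1, a2, a3, a4)) (grad f (b1, b2, b3, b4)))\<^sup>2
      \<le> (Lf * dist (a1, a2, a3, a4) (b1, b2, b3, b4))\<^sup>2"
    by (intro power_mono) auto
  then have "(norm (grad_f1 f a1 a2 a3 a4 - grad_f1 f b1 b2 b3 b4))\<^sup>2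
      + (norm (grad_f2 f a1 a2 a3 a4 - grad_f2 f b1 b2 b3 b4))\<^sup>2
      + (norm (grad_f3 f a1 a2 a3 a4 - grad_f3 f b1 b2 b3 b4))\<^sup>2
      + (norm (grad_f4 f a1 a2 a3 a4 - grad_f4 f b1 b2 b3 b4))\<^sup>2 \<le> N"
    unfolding dist_norm GDERIV_blocks4(5)[OF differentiable(1)] power_mult_distrib N_def
    by (simp add: norm_sq_Pair add_ac)
  moreover have "0 \<le> (norm (grad_f1 f a1 a2 a3 a4 - grad_f1 f b1 b2 b3 b4))\<^sup>2"
    "0 \<le> (norm (grad_f2 f a1 a2 a3 a4 - grad_f2 f b1 b2 b3 b4))\<^sup>2"
    "0 \<le> (norm (grad_f3 f a1 a2 a3 a4 - grad_f3 f b1 b2 b3 b4))\<^sup>2"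
    "0 \<le> (norm (grad_f4 f a1 a2 a3 a4 - grad_f4 f b1 b2 b3 b4))\<^sup>2"
    by simp_all
  ultimately show "(norm (grad_f2 f a1 a2 a3 a4 - grad_f2 f b1 b2 b3 b4))\<^sup>2 \<le> N"
    "(norm (grad_f4 f a1 a2 a3 a4 - grad_f4 f b1 b2 b3 b4))\<^sup>2 \<le> N"
    by linarith+
qed

lemma grad_g_lipschitz:
  assumes "norm a1 \<le> R" "norm a2 \<le> R" "norm b1 \<le> R" "norm b2 \<le> R"
  shows "(norm (grad_g2 g a1 a2 - grad_g2 g b1 b2))\<^sup>2
    \<le> Lg\<^sup>2 * ((norm (a1 - b1))\<^sup>2 + (norm (a2 - b2))\<^sup>2)"
proof -
  have "Lg-lipschitz_on (cball 0 R \<times> cball 0 R) (grad g)"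
    using asm unfolding assumption_A_def lipschitz_on_bounded_def by blast
  then have "dist (grad g (a1, a2)) (grad g (b1, b2)) \<le> Lg * dist (a1, a2) (b1, b2)"
    by (rule lipschitz_onD) (use assms in auto)
  then have "(dist (grad g (a1, a2)) (grad g (b1, b2)))\<^sup>2 \<le> (Lg * dist (a1, a2) (b1, b2))\<^sup>2"
    by (intro power_mono) auto
  then have "(norm (grad_g1 g a1 a2 - grad_g1 g b1 b2))\<^sup>2 + (norm (grad_g2 g a1 a2 - grad_g2 g b1 b2))\<^sup>2
      \<le> Lg\<^sup>2 * ((norm (a1 - b1))\<^sup>2 + (norm (a2 - b2))\<^sup>2)"
    unfolding dist_norm GDERIV_blocks2(3)[OF differentiable(2)] power_mult_distrib
    by (simp add: norm_sq_Pair)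
  then show ?thesis
    using zero_le_power2[of "norm (grad_g1 g a1 a2 - grad_g1 g b1 b2)"] by linarith
qed

text \<open>The terms at \<open>Suc (Suc k)\<close> are grouped to match what \<open>M1\<close> to
  \<open>M4\<close> subtract. Blocks 1 and 2 get \<open>Lf\<^sup>2\<close> from both
  \<open>G2\<close> and \<open>G4\<close>, the new increments of blocks 3 and 4 only from
  \<open>G4\<close>. The terms at \<open>Suc k\<close> are the lag: old increments of blocks 3 and 4
  inside \<open>G2\<close>, and the older proximal terms.\<close>

lemma E_bound:
  "E k \<le> (7 * Lf\<^sup>2 + 4 * Lg\<^sup>2) * (norm (diff_seq x1 (Suc (Suc k))))\<^sup>2
      + ((7 * Lf\<^sup>2 + 4 * Lg\<^sup>2) * (norm (diff_seq x2 (Suc (Suc k))))\<^sup>2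
         + 4 * (norm (H2 *v diff_seq x2 (Suc (Suc k))))\<^sup>2)
      + 3 * Lf\<^sup>2 * (norm (diff_seq x3 (Suc (Suc k))))\<^sup>2
      + (3 * Lf\<^sup>2 * (norm (diff_seq x4 (Suc (Suc k))))\<^sup>2
         + 3 * (norm (H4 *v diff_seq x4 (Suc (Suc k))))\<^sup>2)
      + 4 * (norm (H2 *v diff_seq x2 (Suc k)))\<^sup>2
      + 4 * Lf\<^sup>2 * (norm (diff_seq x3 (Suc k)))\<^sup>2
      + (4 * Lf\<^sup>2 * (norm (diff_seq x4 (Suc k)))\<^sup>2 + 3 * (norm (H4 *v diff_seq x4 (Suc k)))\<^sup>2)"
proof -
  let ?j = "Suc k" and ?l = "Suc (Suc k)"
  let ?f2 = "grad_f2 f (x1 ?l) (x2 ?l) (x3 ?j) (x4 ?j) - grad_f2 f (x1 ?j) (x2 ?j) (x3 k) (x4 k)"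
  let ?g2 = "grad_g2 g (x1 ?l) (x2 ?l) - grad_g2 g (x1 ?j) (x2 ?j)"
  let ?f4 = "grad_f4 f (x1 ?l) (x2 ?l) (x3 ?l) (x4 ?l) - grad_f4 f (x1 ?j) (x2 ?j) (x3 ?j) (x4 ?j)"
  have G2: "G2 ?j - G2 k = ?f2 + ?g2 + H2 *v diff_seq x2 ?l - H2 *v diff_seq x2 ?j"
    unfolding G2_def by simp
  have G4: "G4 ?j - G4 k = ?f4 + H4 *v diff_seq x4 ?l - H4 *v diff_seq x4 ?j"
    unfolding G4_def by simp
  have f2: "(norm ?f2)\<^sup>2 \<le> Lf\<^sup>2 * ((norm (diff_seq x1 ?l))\<^sup>2 + (norm (diff_seq x2 ?l))\<^sup>2
      + (norm (diff_seq x3 ?j))\<^sup>2 + (norm (diff_seq x4 ?j))\<^sup>2)"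
    unfolding diff_seq_Suc by (rule grad_f_lipschitz(1)) (rule bounds)+
  have g2: "(norm ?g2)\<^sup>2 \<le> Lg\<^sup>2 * ((norm (diff_seq x1 ?l))\<^sup>2 + (norm (diff_seq x2 ?l))\<^sup>2)"
    unfolding diff_seq_Suc by (rule grad_g_lipschitz) (rule bounds)+
  have f4: "(norm ?f4)\<^sup>2 \<le> Lf\<^sup>2 * ((norm (diff_seq x1 ?l))\<^sup>2 + (norm (diff_seq x2 ?l))\<^sup>2
      + (norm (diff_seq x3 ?l))\<^sup>2 + (norm (diff_seq x4 ?l))\<^sup>2)"
    unfolding diff_seq_Suc by (rule grad_f_lipschitz(2)) (rule bounds)+
  have "E k \<le> 4 * ((norm ?f2)\<^sup>2 + (norm ?g2)\<^sup>2 + (norm (H2 *v diff_seq x2 ?l))\<^sup>2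
        + (norm (H2 *v diff_seq x2 ?j))\<^sup>2)
      + 3 * ((norm ?f4)\<^sup>2 + (norm (H4 *v diff_seq x4 ?l))\<^sup>2 + (norm (H4 *v diff_seq x4 ?j))\<^sup>2)"
    unfolding E_def G2 G4 by (intro add_mono norm_sq_add4_le norm_sq_add3_le)
  then show ?thesis
    using f2 g2 f4 by (simp add: algebra_simps del: diff_seq_Suc)
qed

section \<open>Descent of the Lyapunov function\<close>

lemma auglag_descent:
  "auglag f g \<beta> (x1 (Suc (Suc k))) (x2 (Suc (Suc k))) (x3 (Suc (Suc k))) (x4 (Suc (Suc k))) (lam (Suc (Suc k)))
      + 1/2 * qnorm H1 (diff_seq x1 (Suc (Suc k))) + qnorm H2 (diff_seq x2 (Suc (Suc k)))
      + qnorm H3 (diff_seq x3 (Suc (Suc k))) + qnorm H4 (diff_seq x4 (Suc (Suc k)))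
    \<le> auglag f g \<beta> (x1 (Suc k)) (x2 (Suc k)) (x3 (Suc k)) (x4 (Suc k)) (lam (Suc k))
      + (norm (diff_seq lam (Suc (Suc k))))\<^sup>2 / (\<tau> * \<beta>)"
proof -
  let ?j = "Suc k" and ?l = "Suc (Suc k)"
  let ?r = "residual (x1 ?l) (x2 ?l) (x3 ?l) (x4 ?l)"
  have "qnorm H1 0 = 0"
    by (simp add: qnorm_def)
  \<comment> \<open>The competitor is the previous iterate. It lies in \<open>M\<close> as the
    result of an earlier update, which the starting point is not; hence the sweep considered begins
    at \<open>Suc k\<close>.\<close>
  then have 1: "auglag f g \<beta> (x1 ?l) (x2 ?j) (x3 ?j) (x4 ?j) (lam ?j) + 1/2 * qnorm H1 (x1 ?l - x1 ?j)
      \<le> auglag f g \<beta> (x1 ?j) (x2 ?j) (x3 ?j) (x4 ?j) (lam ?j)"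
    using argmin(2)[OF argmin(1)[of k], of ?j] by simp
  \<comment> \<open>The residual is the multiplier increment divided by
    \<open>- (\<tau> * \<beta>)\<close>, so the dual step raises the Lagrangian by a multiple of the
    squared increment.\<close>
  have "inner (lam ?l - lam ?j) ?r = - ((norm (lam ?l - lam ?j))\<^sup>2 / (\<tau> * \<beta>))"
    unfolding multiplier_step power2_norm_eq_inner using tau beta_pos by simp
  then have "auglag f g \<beta> (x1 ?l) (x2 ?l) (x3 ?l) (x4 ?l) (lam ?l)
      = auglag f g \<beta> (x1 ?l) (x2 ?l) (x3 ?l) (x4 ?l) (lam ?j) + (norm (lam ?l - lam ?j))\<^sup>2 / (\<tau> * \<beta>)"
    unfolding auglag_def inner_diff_left by linarith
  then show ?thesis
    using 1 block2(1)[of ?j] block3[of ?j] block4(1)[of ?j] unfolding diff_seq_Suc by linarith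
qed

abbreviation \<Psi> where
  "\<Psi> \<equiv> lyapunov f g \<beta> \<tau> Lf Lg H1 H2 H3 H4 x1 x2 x3 x4 lam"

abbreviation Q where
  "Q k \<equiv> qnorm (M1 \<tau> \<beta> Lf Lg H1) (diff_seq x1 k) + qnorm (M2 \<tau> \<beta> Lf Lg H2) (diff_seq x2 k)
    + qnorm (M3 \<tau> \<beta> Lf H3) (diff_seq x3 k) + qnorm (M4 \<tau> \<beta> Lf H4) (diff_seq x4 k)"

text \<open>The part of \<open>E_bound\<close> at the new increments cancels against the subtracted
  parts of the metrics in \<open>\<Psi> (Suc (Suc k))\<close>; the lagged part is what remains on
  the right.\<close>

lemma lyapunov_step:
  "\<Psi> (Suc (Suc k)) + Q (Suc k) \<le> \<Psi> (Suc k) + \<alpha>2 \<tau> / \<beta> *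
     (4 * (norm (H2 *v diff_seq x2 (Suc k)))\<^sup>2 + 4 * Lf\<^sup>2 * (norm (diff_seq x3 (Suc k)))\<^sup>2
      + (4 * Lf\<^sup>2 * (norm (diff_seq x4 (Suc k)))\<^sup>2 + 3 * (norm (H4 *v diff_seq x4 (Suc k)))\<^sup>2))"
proof -
  have "0 \<le> \<alpha>2 \<tau> / \<beta>"
    using tau beta_pos by (simp add: \<alpha>2_def)
  from mult_left_mono[OF E_bound[of k] this] auglag_descent[of k] multiplier_bound[of k]
  show ?thesis
    unfolding lyapunov_def qnorm_M diff_seq_Suc[of lam] right_diff_distrib distrib_left mult.assoc
    by linarith
qed

text \<open>By the factor 8 in \<open>beta_large\<close>, each error term is at most
  \<open>h / 8\<close> times a squared norm. So \<open>M1\<close> keeps at least 3/8 of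
  \<open>h\<close> and the other metrics 7/8, all above \<open>h / 4\<close>, while each lagged term
  stays below half of its metric.\<close>

lemma M_bounds:
  "h / 4 * (norm a)\<^sup>2 \<le> qnorm (M1 \<tau> \<beta> Lf Lg H1) a"
  "h / 4 * (norm a)\<^sup>2 \<le> qnorm (M2 \<tau> \<beta> Lf Lg H2) a"
  "h / 4 * (norm b)\<^sup>2 \<le> qnorm (M3 \<tau> \<beta> Lf H3) b"
  "h / 4 * (norm b)\<^sup>2 \<le> qnorm (M4 \<tau> \<beta> Lf H4) b"
  "\<alpha>2 \<tau> / \<beta> * (4 * (norm (H2 *v a))\<^sup>2) \<le> 1/2 * qnorm (M2 \<tau> \<beta> Lf Lg H2) a"
  "\<alpha>2 \<tau> / \<beta> * (4 * Lf\<^sup>2 * (norm b)\<^sup>2) \<le> 1/2 * qnorm (M3 \<tau> \<beta> Lf H3) b"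
  "\<alpha>2 \<tau> / \<beta> * (4 * Lf\<^sup>2 * (norm b)\<^sup>2 + 3 * (norm (H4 *v b))\<^sup>2) \<le> 1/2 * qnorm (M4 \<tau> \<beta> Lf H4) b"
proof -
  define s where "s = \<alpha>2 \<tau> / \<beta>"
  have s: "0 \<le> s"
    using tau beta_pos by (simp add: s_def \<alpha>2_def)
  have small: "s * (7 * Lf\<^sup>2 + 4 * Lg\<^sup>2 + 4 * C) \<le> h / 8"
    using beta_large beta_pos by (simp add: s_def field_simps)
  have bound: "s * y \<le> h / 8 * t" if "y \<le> (7 * Lf\<^sup>2 + 4 * Lg\<^sup>2 + 4 * C) * t" "0 \<le> t" for y t
  proof -
    have "s * y \<le> s * (7 * Lf\<^sup>2 + 4 * Lg\<^sup>2 + 4 * C) * t"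
      using mult_left_mono[OF that(1) s] by (simp add: mult.assoc)
    also have "\<dots> \<le> h / 8 * t"
      using mult_right_mono[OF small that(2)] .
    finally show ?thesis .
  qed
  have nonneg: "0 \<le> Lf\<^sup>2 * (norm x)\<^sup>2" "0 \<le> Lg\<^sup>2 * (norm x)\<^sup>2" "0 \<le> C * (norm x)\<^sup>2" "0 \<le> h * (norm x)\<^sup>2"
    for x :: "'b::real_normed_vector"
    using C_nonneg h_pos by simp_all
  have b1: "s * ((7 * Lf\<^sup>2 + 4 * Lg\<^sup>2) * (norm a)\<^sup>2) \<le> h / 8 * (norm a)\<^sup>2"
    by (rule bound) (use nonneg[of a] in \<open>(simp; fail | unfold distrib_right mult.assoc, linarith)+\<close>)
  have b2: "s * ((7 * Lf\<^sup>2 + 4 * Lg\<^sup>2) * (norm a)\<^sup>2 + 4 * (norm (H2 *v a))\<^sup>2) \<le> h / 8 * (norm a)\<^sup>2"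
    by (rule bound) (use nonneg[of a] H_bound(1)[of a] in \<open>(simp; fail | unfold distrib_right mult.assoc, linarith)+\<close>)
  have b2': "s * (4 * (norm (H2 *v a))\<^sup>2) \<le> h / 8 * (norm a)\<^sup>2"
    by (rule bound) (use nonneg[of a] H_bound(1)[of a] in \<open>(simp; fail | unfold distrib_right mult.assoc, linarith)+\<close>)
  have b3: "s * (3 * Lf\<^sup>2 * (norm b)\<^sup>2) \<le> h / 8 * (norm b)\<^sup>2"
    by (rule bound) (use nonneg[of b] in \<open>(simp; fail | unfold distrib_right mult.assoc, linarith)+\<close>)
  have b3': "s * (4 * Lf\<^sup>2 * (norm b)\<^sup>2) \<le> h / 8 * (norm b)\<^sup>2"
    by (rule bound) (use nonneg[of b] in \<open>(simp; fail | unfold distrib_right mult.assoc, linarith)+\<close>)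
  have b4: "s * (3 * Lf\<^sup>2 * (norm b)\<^sup>2 + 3 * (norm (H4 *v b))\<^sup>2) \<le> h / 8 * (norm b)\<^sup>2"
    by (rule bound) (use nonneg[of b] H_bound(2)[of b] in \<open>(simp; fail | unfold distrib_right mult.assoc, linarith)+\<close>)
  have b4': "s * (4 * Lf\<^sup>2 * (norm b)\<^sup>2 + 3 * (norm (H4 *v b))\<^sup>2) \<le> h / 8 * (norm b)\<^sup>2"
    by (rule bound) (use nonneg[of b] H_bound(2)[of b] in \<open>(simp; fail | unfold distrib_right mult.assoc, linarith)+\<close>)
  note c = coercive(1,2)[of a] coercive(3,4)[of b] nonneg(4)[of a] nonneg(4)[of b]
  show "h / 4 * (norm a)\<^sup>2 \<le> qnorm (M1 \<tau> \<beta> Lf Lg H1) a"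
    unfolding qnorm_M s_def[symmetric] using b1 c by simp
  show "h / 4 * (norm a)\<^sup>2 \<le> qnorm (M2 \<tau> \<beta> Lf Lg H2) a"
    unfolding qnorm_M s_def[symmetric] using b2 c by simp
  show "h / 4 * (norm b)\<^sup>2 \<le> qnorm (M3 \<tau> \<beta> Lf H3) b"
    unfolding qnorm_M s_def[symmetric] using b3 c by simp
  show "h / 4 * (norm b)\<^sup>2 \<le> qnorm (M4 \<tau> \<beta> Lf H4) b"
    unfolding qnorm_M s_def[symmetric] using b4 c by simp
  show "\<alpha>2 \<tau> / \<beta> * (4 * (norm (H2 *v a))\<^sup>2) \<le> 1/2 * qnorm (M2 \<tau> \<beta> Lf Lg H2) a"
    unfolding qnorm_M s_def[symmetric] using b2 b2' c by simp
  show "\<alpha>2 \<tau> / \<beta> * (4 * Lf\<^sup>2 * (norm b)\<^sup>2) \<le> 1/2 * qnorm (M3 \<tau> \<beta> Lf H3) b"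
    unfolding qnorm_M s_def[symmetric] using b3 b3' c by simp
  show "\<alpha>2 \<tau> / \<beta> * (4 * Lf\<^sup>2 * (norm b)\<^sup>2 + 3 * (norm (H4 *v b))\<^sup>2) \<le> 1/2 * qnorm (M4 \<tau> \<beta> Lf H4) b"
    unfolding qnorm_M s_def[symmetric] using b4 b4' c by simp
qed

lemma Q_lower:
  "h / 4 * ((norm (diff_seq x1 k))\<^sup>2 + (norm (diff_seq x2 k))\<^sup>2 + (norm (diff_seq x3 k))\<^sup>2
    + (norm (diff_seq x4 k))\<^sup>2) \<le> Q k"
  unfolding distrib_left by (intro add_mono M_bounds)

lemma Q_nonneg: "0 \<le> Q k"
  by (rule order_trans[OF _ Q_lower]) (use h_pos in simp)

text \<open>Block 1 has no lagged term, so nonnegativity of its metric is enough; the other blocks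
  spend half of their metric. Doubling avoids fractions.\<close>

lemma sufficient_decrease: "Q (Suc k) + 2 * \<Psi> (Suc (Suc k)) \<le> 2 * \<Psi> (Suc k)"
proof -
  have "0 \<le> qnorm (M1 \<tau> \<beta> Lf Lg H1) (diff_seq x1 (Suc k))"
    by (rule order_trans[OF _ M_bounds(1)]) (use h_pos in simp)
  then show ?thesis
    using lyapunov_step[of k] M_bounds(5)[of "diff_seq x2 (Suc k)"]
      M_bounds(6)[of "diff_seq x3 (Suc k)"] M_bounds(7)[of "diff_seq x4 (Suc k)"]
    unfolding distrib_left by linarith
qed

section \<open>Lower bound and vanishing increments\<close>

lemma lyapunov_bounded_below: "\<exists>b. \<forall>k. b \<le> \<Psi> (Suc k)"
proof -
  have bdd: "bdd_below (f ` (M \<times> UNIV \<times> UNIV \<times> UNIV))" "bdd_below (g ` (M \<times> UNIV))"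
    using asm unfolding assumption_A_def by - (elim conjE, assumption)+
  obtain bf where bf: "\<And>p. p \<in> M \<times> UNIV \<times> UNIV \<times> UNIV \<Longrightarrow> bf \<le> f p"
    using bdd(1) unfolding bdd_below_def by blast
  obtain bg where bg: "\<And>p. p \<in> M \<times> UNIV \<Longrightarrow> bg \<le> g p"
    using bdd(2) unfolding bdd_below_def by blast
  obtain B where B: "\<And>k. norm (lam k) \<le> B"
    using lam_bounded unfolding bounded_iff by blast
  have "bf + bg - B\<^sup>2 / (2 * \<beta>) \<le> \<Psi> (Suc k)" for k
  proof -
    let ?l = "lam (Suc k)" and ?r = "residual (x1 (Suc k)) (x2 (Suc k)) (x3 (Suc k)) (x4 (Suc k))"
    \<comment> \<open>Completing the square bounds multiplier and penalty terms from below by the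
      multiplier alone.\<close>
    have "0 \<le> (norm (\<beta> *\<^sub>R ?r - ?l))\<^sup>2 / (2 * \<beta>)"
      using beta_pos by simp
    also have "\<dots> = \<beta> / 2 * (norm ?r)\<^sup>2 - inner ?l ?r + (norm ?l)\<^sup>2 / (2 * \<beta>)"
      using beta_pos unfolding power2_norm_eq_inner
      by (simp add: inner_diff_left inner_diff_right inner_commute[of ?r ?l] field_simps)
    finally have 1: "- ((norm ?l)\<^sup>2 / (2 * \<beta>)) \<le> \<beta> / 2 * (norm ?r)\<^sup>2 - inner ?l ?r"
      by linarith
    have 2: "(norm ?l)\<^sup>2 / (2 * \<beta>) \<le> B\<^sup>2 / (2 * \<beta>)"
      using B beta_pos by (intro divide_right_mono power_mono) auto
    have 3: "bf \<le> f (x1 (Suc k), x2 (Suc k), x3 (Suc k), x4 (Suc k))" "bg \<le> g (x1 (Suc k), x2 (Suc k))"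
      using bf bg argmin(1) by auto
    have 4: "0 \<le> \<alpha>1 \<tau> / (\<tau> * \<beta>) * (norm (diff_seq lam (Suc k)))\<^sup>2"
      using relaxation_factor tau beta_pos by (simp add: \<alpha>1_def del: diff_seq_Suc)
    show ?thesis
      using 1 2 3 4 Q_nonneg[of "Suc k"] unfolding lyapunov_def auglag_def by linarith
  qed
  then show ?thesis
    by blast
qed

lemma diff_norms_tendsto_0:
  "(\<lambda>k. (norm (diff_seq x1 (Suc k)))\<^sup>2 + (norm (diff_seq x2 (Suc k)))\<^sup>2
    + (norm (diff_seq x3 (Suc k)))\<^sup>2 + (norm (diff_seq x4 (Suc k)))\<^sup>2) \<longlonglongrightarrow> 0" (is "?N \<longlonglongrightarrow> 0")
proof -
  obtain b where b: "\<forall>k. b \<le> \<Psi> (Suc k)"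
    using lyapunov_bounded_below by blast
  have step: "\<Psi> (Suc (Suc k)) \<le> \<Psi> (Suc k)" for k
    using sufficient_decrease[of k] Q_nonneg[of "Suc k"] by linarith
  then have "decseq (\<lambda>k. \<Psi> (Suc k))"
    by (simp add: decseq_Suc_iff)
  then obtain l where l: "(\<lambda>k. \<Psi> (Suc k)) \<longlonglongrightarrow> l"
    using b decseq_convergent by blast
  then have "(\<lambda>k. \<Psi> (Suc k) - \<Psi> (Suc (Suc k))) \<longlonglongrightarrow> 0"
    using tendsto_diff[OF l LIMSEQ_Suc[OF l]] by simp
  \<comment> \<open>The constant combines the \<open>h / 4\<close> of \<open>Q_lower\<close> with
    the 2 of \<open>sufficient_decrease\<close>.\<close>
  then have lim: "(\<lambda>k. 8 / h * (\<Psi> (Suc k) - \<Psi> (Suc (Suc k)))) \<longlonglongrightarrow> 0"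
    by (rule tendsto_mult_right_zero)
  show ?thesis
  proof (rule tendsto_sandwich[OF _ _ tendsto_const lim])
    show "\<forall>\<^sub>F k in sequentially. 0 \<le> ?N k"
      by simp
    have "?N k \<le> 8 / h * (\<Psi> (Suc k) - \<Psi> (Suc (Suc k)))" for k
    proof -
      have "h / 8 * ?N k \<le> \<Psi> (Suc k) - \<Psi> (Suc (Suc k))"
        using Q_lower[of "Suc k"] sufficient_decrease[of k] by linarith
      then show ?thesis
        using h_pos by (simp add: field_simps)
    qed
    then show "\<forall>\<^sub>F k in sequentially. ?N k \<le> 8 / h * (\<Psi> (Suc k) - \<Psi> (Suc (Suc k)))"
      by simp
  qed
qed

lemma primal_diff_tendsto_0:
  "diff_seq x1 \<longlonglongrightarrow> 0" "diff_seq x2 \<longlonglongrightarrow> 0" "diff_seq x3 \<longlonglongrightarrow> 0" "diff_seq x4 \<longlonglongrightarrow> 0"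
proof -
  have *: "d \<longlonglongrightarrow> 0" if "\<And>k. (norm (d (Suc k)))\<^sup>2 \<le> (norm (diff_seq x1 (Suc k)))\<^sup>2
    + (norm (diff_seq x2 (Suc k)))\<^sup>2 + (norm (diff_seq x3 (Suc k)))\<^sup>2 + (norm (diff_seq x4 (Suc k)))\<^sup>2"
    for d :: "nat \<Rightarrow> 'z::real_normed_vector"
  proof -
    have "(\<lambda>k. (norm (d (Suc k)))\<^sup>2) \<longlonglongrightarrow> 0"
      by (rule tendsto_sandwich[OF _ _ tendsto_const diff_norms_tendsto_0]) (use that in auto)
    then have "(\<lambda>k. d (Suc k)) \<longlonglongrightarrow> 0"
      using tendsto_real_sqrt tendsto_norm_zero_cancel by fastforce
    then show ?thesis
      using LIMSEQ_imp_Suc by blast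
  qed
  show "diff_seq x1 \<longlonglongrightarrow> 0" "diff_seq x2 \<longlonglongrightarrow> 0" "diff_seq x3 \<longlonglongrightarrow> 0" "diff_seq x4 \<longlonglongrightarrow> 0"
    by (rule *; simp del: diff_seq_Suc)+
qed

text \<open>The decrease of \<open>\<Psi>\<close> controls primal increments only. The multiplier
  recursion is therefore used a second time, now as a contraction whose perturbation
  \<open>E\<close> vanishes with those increments.\<close>

lemma dual_diff_tendsto_0: "diff_seq lam \<longlonglongrightarrow> 0"
proof -
  have mult: "(\<lambda>k. A *v x k) \<longlonglongrightarrow> 0" if "x \<longlonglongrightarrow> 0"
    for A :: "real ^ 'k::finite ^ 'l::finite" and x
    using bounded_linear.tendsto[OF matrix_vector_mul_bounded_linear that, of A] by simp
  note d = primal_diff_tendsto_0[THEN LIMSEQ_Suc]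
  note d' = d[THEN LIMSEQ_Suc]
  have "E \<longlonglongrightarrow> 0"
  proof (rule tendsto_sandwich[OF _ always_eventually[OF allI[OF E_bound]] tendsto_const])
    show "\<forall>\<^sub>F k in sequentially. 0 \<le> E k"
      by (simp add: E_def)
  qed (intro tendsto_add_zero tendsto_mult_right_zero tendsto_null_power tendsto_norm_zero mult d d' zero_less_numeral)
  then have "(\<lambda>k. \<tau>\<^sup>2 / (1 - \<bar>1 - \<tau>\<bar>) * E k) \<longlonglongrightarrow> 0"
    by (rule tendsto_mult_right_zero)
  then have "(\<lambda>k. (norm (lam (Suc k) - lam k))\<^sup>2) \<longlonglongrightarrow> 0"
    by (rule contraction_tendsto_0[where a = "\<lambda>k. (norm (lam (Suc k) - lam k))\<^sup>2", rotated 4])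
      (use relaxation_factor multiplier_contraction in auto)
  then have "(\<lambda>k. lam (Suc k) - lam k) \<longlonglongrightarrow> 0"
    using tendsto_real_sqrt tendsto_norm_zero_cancel by fastforce
  then show ?thesis
    using LIMSEQ_imp_Suc[of "diff_seq lam"] by simp
qed

section \<open>Limit points\<close>

lemma auglag_tendsto:
  assumes "(a1 \<longlongrightarrow> b1) F" "(a2 \<longlongrightarrow> b2) F" "(a3 \<longlongrightarrow> b3) F" "(a4 \<longlongrightarrow> b4) F" "(l \<longlongrightarrow> l') F"
  shows "((\<lambda>j. auglag f g \<beta> (a1 j) (a2 j) (a3 j) (a4 j) (l j)) \<longlongrightarrow> auglag f g \<beta> b1 b2 b3 b4 l') F"
proof -
  have "isCont f (b1, b2, b3, b4)" "isCont g (b1, b2)"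
    using differentiable differentiable_imp_continuous_within by blast+
  then show ?thesis
    unfolding auglag_def residual_def
    by (intro tendsto_intros isCont_tendsto_compose[of _ f] isCont_tendsto_compose[of _ g]
        bounded_linear.tendsto[OF matrix_vector_mul_bounded_linear] assms)
qed

lemma qnorm_tendsto:
  assumes "(a \<longlongrightarrow> b) F"
  shows "((\<lambda>j. 1/2 * qnorm H (a j)) \<longlongrightarrow> 1/2 * qnorm H b) F"
  unfolding qnorm_def
  by (intro tendsto_intros bounded_linear.tendsto[OF matrix_vector_mul_bounded_linear] assms)

text \<open>Passing to the limit in the minimality of the iterates, rather than in their first-order
  conditions, makes the limit point itself a block-wise minimizer; so neither continuity of the
  tangent spaces nor of the gradients is needed.\<close>

lemma limit_point_stationary:
  assumes r: "strict_mono r"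
    and lim: "((\<lambda>k. (x1 k, x2 k, x3 k, x4 k, lam k)) \<circ> r) \<longlonglongrightarrow> (y1, y2, y3, y4, mu)"
    and y1: "closed M \<or> y1 \<in> M"
  shows "stationary M f g y1 y2 y3 y4 mu"
proof -
  have l: "(\<lambda>j. x1 (r j)) \<longlonglongrightarrow> y1" "(\<lambda>j. x2 (r j)) \<longlonglongrightarrow> y2" "(\<lambda>j. x3 (r j)) \<longlonglongrightarrow> y3"
    "(\<lambda>j. x4 (r j)) \<longlonglongrightarrow> y4" "(\<lambda>j. lam (r j)) \<longlonglongrightarrow> mu"
    using tendsto_fst[OF lim] tendsto_fst[OF tendsto_snd[OF lim]]
      tendsto_fst[OF tendsto_snd[OF tendsto_snd[OF lim]]]
      tendsto_fst[OF tendsto_snd[OF tendsto_snd[OF tendsto_snd[OF lim]]]]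
      tendsto_snd[OF tendsto_snd[OF tendsto_snd[OF tendsto_snd[OF lim]]]]
    by (simp_all add: o_def)
  \<comment> \<open>Each update mixes two consecutive iterates. As increments vanish, the shifted
    subsequence has the same limit, so all arguments of the minimality statements converge.\<close>
  have prev: "(\<lambda>j. x (r j - 1)) \<longlonglongrightarrow> y" if "(\<lambda>j. x (r j)) \<longlonglongrightarrow> y" "diff_seq x \<longlonglongrightarrow> 0"
    for x :: "nat \<Rightarrow> 'z::real_normed_vector" and y
    using tendsto_diff[OF that(1) LIMSEQ_subseq_LIMSEQ[OF that(2) r]] by (simp add: diff_seq_def o_def)
  note p = prev[OF l(1) primal_diff_tendsto_0(1)] prev[OF l(2) primal_diff_tendsto_0(2)]
    prev[OF l(3) primal_diff_tendsto_0(3)] prev[OF l(4) primal_diff_tendsto_0(4)]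
    prev[OF l(5) dual_diff_tendsto_0]
  \<comment> \<open>Truncated subtraction is exact once \<open>r j \<ge> 1\<close>, which holds from
    \<open>j = 1\<close> on.\<close>
  have Suc_r: "\<forall>\<^sub>F j in sequentially. r j = Suc (r j - 1)"
    using eventually_ge_at_top[of 1]
  proof eventually_elim
    case (elim j)
    then show ?case
      using seq_suble[OF r, of j] by linarith
  qed
  have y1M: "y1 \<in> M"
    using y1
  proof
    assume "closed M"
    moreover have "\<forall>\<^sub>F j in sequentially. x1 (r j) \<in> M"
      using Suc_r by eventually_elim (metis argmin(1))
    ultimately show ?thesis
      by (rule Lim_in_closed_set[OF _ _ sequentially_bot l(1)])
  qed
  \<comment> \<open>Feasibility comes from the dual side: up to the nonzero factor
    \<open>- (\<tau> * \<beta>)\<close>, residuals are multiplier increments.\<close>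
  have "residual y1 y2 y3 y4 = 0"
  proof -
    let ?res = "\<lambda>j. residual (x1 (r j)) (x2 (r j)) (x3 (r j)) (x4 (r j))"
    have "?res \<longlonglongrightarrow> residual y1 y2 y3 y4"
      unfolding residual_def
      by (intro tendsto_intros bounded_linear.tendsto[OF matrix_vector_mul_bounded_linear] l)
    then have "(\<lambda>j. - ((\<tau> * \<beta>) *\<^sub>R ?res j)) \<longlonglongrightarrow> - ((\<tau> * \<beta>) *\<^sub>R residual y1 y2 y3 y4)"
      by (intro tendsto_intros)
    moreover have "\<forall>\<^sub>F j in sequentially. - ((\<tau> * \<beta>) *\<^sub>R ?res j) = lam (r j) - lam (r j - 1)"
      using Suc_r by eventually_elim (metis multiplier_step)
    ultimately have "(\<lambda>j. lam (r j) - lam (r j - 1)) \<longlonglongrightarrow> - ((\<tau> * \<beta>) *\<^sub>R residual y1 y2 y3 y4)"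
      by (rule Lim_transform_eventually)
    from LIMSEQ_unique[OF this tendsto_diff[OF l(5) p(5)]] show ?thesis
      using tau beta_pos by simp
  qed
  then have res: "A1 *v y1 + (A2 *v y2 + A3 *v y3 + A4 *v y4) = 0"
    "A2 *v y2 + (A1 *v y1 + A3 *v y3 + A4 *v y4) = 0"
    "A3 *v y3 + (A1 *v y1 + A2 *v y2 + A4 *v y4) = 0"
    "A4 *v y4 + (A1 *v y1 + A2 *v y2 + A3 *v y3) = 0"
    unfolding residual_blocks by simp_all
  \<comment> \<open>The vanishing term in \<open>y1 - y1\<close> is kept, so that the statement has
    the shape of a proximal step centred at its own minimizer.\<close>
  have min1: "auglag f g \<beta> y1 y2 y3 y4 mu + 1/2 * qnorm H1 (y1 - y1)
      \<le> auglag f g \<beta> z y2 y3 y4 mu + 1/2 * qnorm H1 (z - y1)" if "z \<in> M" for z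
  proof (rule tendsto_le[OF sequentially_bot])
    show "(\<lambda>j. auglag f g \<beta> (x1 (r j)) (x2 (r j - 1)) (x3 (r j - 1)) (x4 (r j - 1)) (lam (r j - 1))
        + 1/2 * qnorm H1 (x1 (r j) - x1 (r j - 1)))
      \<longlonglongrightarrow> auglag f g \<beta> y1 y2 y3 y4 mu + 1/2 * qnorm H1 (y1 - y1)"
      by (intro tendsto_add tendsto_diff auglag_tendsto qnorm_tendsto l p)
    show "(\<lambda>j. auglag f g \<beta> z (x2 (r j - 1)) (x3 (r j - 1)) (x4 (r j - 1)) (lam (r j - 1))
        + 1/2 * qnorm H1 (z - x1 (r j - 1)))
      \<longlonglongrightarrow> auglag f g \<beta> z y2 y3 y4 mu + 1/2 * qnorm H1 (z - y1)"
      by (intro tendsto_add tendsto_diff tendsto_const auglag_tendsto qnorm_tendsto p)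
    show "\<forall>\<^sub>F j in sequentially.
        auglag f g \<beta> (x1 (r j)) (x2 (r j - 1)) (x3 (r j - 1)) (x4 (r j - 1)) (lam (r j - 1))
          + 1/2 * qnorm H1 (x1 (r j) - x1 (r j - 1))
        \<le> auglag f g \<beta> z (x2 (r j - 1)) (x3 (r j - 1)) (x4 (r j - 1)) (lam (r j - 1))
          + 1/2 * qnorm H1 (z - x1 (r j - 1))"
      using Suc_r by eventually_elim (metis argmin(2)[OF that])
  qed
  have min2: "auglag f g \<beta> y1 y2 y3 y4 mu + 1/2 * qnorm H2 (y2 - y2)
      \<le> auglag f g \<beta> y1 z y3 y4 mu + 1/2 * qnorm H2 (z - y2)" for z
  proof (rule tendsto_le[OF sequentially_bot])
    show "(\<lambda>j. auglag f g \<beta> (x1 (r j)) (x2 (r j)) (x3 (r j - 1)) (x4 (r j - 1)) (lam (r j - 1))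
        + 1/2 * qnorm H2 (x2 (r j) - x2 (r j - 1)))
      \<longlonglongrightarrow> auglag f g \<beta> y1 y2 y3 y4 mu + 1/2 * qnorm H2 (y2 - y2)"
      by (intro tendsto_add tendsto_diff auglag_tendsto qnorm_tendsto l p)
    show "(\<lambda>j. auglag f g \<beta> (x1 (r j)) z (x3 (r j - 1)) (x4 (r j - 1)) (lam (r j - 1))
        + 1/2 * qnorm H2 (z - x2 (r j - 1)))
      \<longlonglongrightarrow> auglag f g \<beta> y1 z y3 y4 mu + 1/2 * qnorm H2 (z - y2)"
      by (intro tendsto_add tendsto_diff tendsto_const auglag_tendsto qnorm_tendsto l p)
    show "\<forall>\<^sub>F j in sequentially.
        auglag f g \<beta> (x1 (r j)) (x2 (r j)) (x3 (r j - 1)) (x4 (r j - 1)) (lam (r j - 1))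
          + 1/2 * qnorm H2 (x2 (r j) - x2 (r j - 1))
        \<le> auglag f g \<beta> (x1 (r j)) z (x3 (r j - 1)) (x4 (r j - 1)) (lam (r j - 1))
          + 1/2 * qnorm H2 (z - x2 (r j - 1))"
      using Suc_r by eventually_elim (metis argmin(3))
  qed
  have min3: "auglag f g \<beta> y1 y2 y3 y4 mu + 1/2 * qnorm H3 (y3 - y3)
      \<le> auglag f g \<beta> y1 y2 z y4 mu + 1/2 * qnorm H3 (z - y3)" for z
  proof (rule tendsto_le[OF sequentially_bot])
    show "(\<lambda>j. auglag f g \<beta> (x1 (r j)) (x2 (r j)) (x3 (r j)) (x4 (r j - 1)) (lam (r j - 1))
        + 1/2 * qnorm H3 (x3 (r j) - x3 (r j - 1)))
      \<longlonglongrightarrow> auglag f g \<beta> y1 y2 y3 y4 mu + 1/2 * qnorm H3 (y3 - y3)"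
      by (intro tendsto_add tendsto_diff auglag_tendsto qnorm_tendsto l p)
    show "(\<lambda>j. auglag f g \<beta> (x1 (r j)) (x2 (r j)) z (x4 (r j - 1)) (lam (r j - 1))
        + 1/2 * qnorm H3 (z - x3 (r j - 1)))
      \<longlonglongrightarrow> auglag f g \<beta> y1 y2 z y4 mu + 1/2 * qnorm H3 (z - y3)"
      by (intro tendsto_add tendsto_diff tendsto_const auglag_tendsto qnorm_tendsto l p)
    show "\<forall>\<^sub>F j in sequentially.
        auglag f g \<beta> (x1 (r j)) (x2 (r j)) (x3 (r j)) (x4 (r j - 1)) (lam (r j - 1))
          + 1/2 * qnorm H3 (x3 (r j) - x3 (r j - 1))
        \<le> auglag f g \<beta> (x1 (r j)) (x2 (r j)) z (x4 (r j - 1)) (lam (r j - 1))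
          + 1/2 * qnorm H3 (z - x3 (r j - 1))"
      using Suc_r by eventually_elim (metis argmin(4))
  qed
  have min4: "auglag f g \<beta> y1 y2 y3 y4 mu + 1/2 * qnorm H4 (y4 - y4)
      \<le> auglag f g \<beta> y1 y2 y3 z mu + 1/2 * qnorm H4 (z - y4)" for z
  proof (rule tendsto_le[OF sequentially_bot])
    show "(\<lambda>j. auglag f g \<beta> (x1 (r j)) (x2 (r j)) (x3 (r j)) (x4 (r j)) (lam (r j - 1))
        + 1/2 * qnorm H4 (x4 (r j) - x4 (r j - 1)))
      \<longlonglongrightarrow> auglag f g \<beta> y1 y2 y3 y4 mu + 1/2 * qnorm H4 (y4 - y4)"
      by (intro tendsto_add tendsto_diff auglag_tendsto qnorm_tendsto l p)
    show "(\<lambda>j. auglag f g \<beta> (x1 (r j)) (x2 (r j)) (x3 (r j)) z (lam (r j - 1))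
        + 1/2 * qnorm H4 (z - x4 (r j - 1)))
      \<longlonglongrightarrow> auglag f g \<beta> y1 y2 y3 z mu + 1/2 * qnorm H4 (z - y4)"
      by (intro tendsto_add tendsto_diff tendsto_const auglag_tendsto qnorm_tendsto l p)
    show "\<forall>\<^sub>F j in sequentially.
        auglag f g \<beta> (x1 (r j)) (x2 (r j)) (x3 (r j)) (x4 (r j)) (lam (r j - 1))
          + 1/2 * qnorm H4 (x4 (r j) - x4 (r j - 1))
        \<le> auglag f g \<beta> (x1 (r j)) (x2 (r j)) (x3 (r j)) z (lam (r j - 1))
          + 1/2 * qnorm H4 (z - x4 (r j - 1))"
      using Suc_r by eventually_elim (metis argmin(5))
  qed
  \<comment> \<open>In the gradient of the proximal objective, the proximal part vanishes at its
    centre and the penalty part because the residual is 0; only \<open>mu\<close> is left.\<close>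
  have "inner v (grad_f1 f y1 y2 y3 y4 + grad_g1 g y1 y2 - transpose A1 *v mu) = 0"
    if "v \<in> tangent_space M y1" for v
    using tangent_first_order[OF GDERIV_proximal[OF GDERIV_add[OF f_partial(1) g_partial(1)] sym(1)],
        OF min1[unfolded auglag_blocks(1)] that]
    by (simp add: res)
  then have "orth_proj (tangent_space M y1)
      (grad_f1 f y1 y2 y3 y4 + grad_g1 g y1 y2 - transpose A1 *v mu) = 0"
    by (intro orth_proj_eq_0 zero_in_tangent_space y1M)
  moreover have "grad_f2 f y1 y2 y3 y4 + grad_g2 g y1 y2 - transpose A2 *v mu = 0"
    using GDERIV_min_zero[OF GDERIV_proximal[OF GDERIV_add[OF f_partial(2) g_partial(2)] sym(2)],
        OF min2[unfolded auglag_blocks(2)]]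
    by (simp add: res)
  moreover have "grad_f3 f y1 y2 y3 y4 - transpose A3 *v mu = 0"
    using GDERIV_min_zero[OF GDERIV_proximal[OF GDERIV_add[OF f_partial(3) GDERIV_const] sym(3)],
        OF min3[unfolded auglag_blocks(3)]]
    by (simp add: res)
  moreover have "grad_f4 f y1 y2 y3 y4 - transpose A4 *v mu = 0"
    using GDERIV_min_zero[OF GDERIV_proximal[OF GDERIV_add[OF f_partial(4) GDERIV_const] sym(4)],
        OF min4[unfolded auglag_blocks(4)]]
    by (simp add: res)
  ultimately show ?thesis
    unfolding stationary_def using y1M \<open>residual y1 y2 y3 y4 = 0\<close> by blast
qed

end

section \<open>Choice of the threshold and assembly of the claims\<close>

theorem theorem1:
  fixes \<tau> Lf Lg Lf1 Lf2 Lf3 Lf4 Lg1 Lg2 :: real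
    and H1 H2 :: "real ^ ('n::finite \<times> 4) ^ ('n \<times> 4)"
    and H3 H4 :: "real ^ ('n \<times> 3) ^ ('n \<times> 3)"
  assumes "0 < \<tau>" and "\<tau> < 2"
    and "vertex_scaling H1" and "vertex_scaling H2" and "vertex_scaling H3" and "vertex_scaling H4"
  shows "\<exists>\<beta>low>0. \<forall>\<beta>>\<beta>low.
    \<forall>(M :: 'n vec4 set) (f :: 'n point \<Rightarrow> real) (g :: 'n vec4 \<times> 'n vec4 \<Rightarrow> real) (R :: real)
      (x1 :: nat \<Rightarrow> 'n vec4) (x2 :: nat \<Rightarrow> 'n vec4) (x3 :: nat \<Rightarrow> 'n vec3) (x4 :: nat \<Rightarrow> 'n vec3)
      (lam :: nat \<Rightarrow> 'n dual).
      embedded_submanifold M \<and>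
      0 < R \<and>
      assumption_A M f g R Lf Lg Lf1 Lf2 Lf3 Lf4 Lg1 Lg2 \<and>
      pradmm M f g \<beta> \<tau> H1 H2 H3 H4 x1 x2 x3 x4 lam \<and>
      (\<forall>k. norm (x1 k) \<le> R \<and> norm (x2 k) \<le> R \<and> norm (x3 k) \<le> R \<and> norm (x4 k) \<le> R) \<and>
      bounded (range lam)
      \<longrightarrow>
      (\<forall>k\<ge>1. lyapunov f g \<beta> \<tau> Lf Lg H1 H2 H3 H4 x1 x2 x3 x4 lam (Suc k)
              \<le> lyapunov f g \<beta> \<tau> Lf Lg H1 H2 H3 H4 x1 x2 x3 x4 lam k) \<and>
      (\<exists>\<delta>1 \<delta>2 \<delta>3 \<delta>4 :: real.
         0 < \<delta>1 \<and> \<delta>1 < 1 \<and> 0 < \<delta>2 \<and> \<delta>2 < 1 \<and> 0 < \<delta>3 \<and> \<delta>3 < 1 \<and> 0 < \<delta>4 \<and> \<delta>4 < 1 \<and>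
         (\<forall>k\<ge>1.
            let rhs = (1 - \<delta>1) * qnorm (M1 \<tau> \<beta> Lf Lg H1) (diff_seq x1 k)
                    + (1 - \<delta>2) * qnorm (M2 \<tau> \<beta> Lf Lg H2) (diff_seq x2 k)
                    + (1 - \<delta>3) * qnorm (M3 \<tau> \<beta> Lf H3) (diff_seq x3 k)
                    + (1 - \<delta>4) * qnorm (M4 \<tau> \<beta> Lf H4) (diff_seq x4 k)
            in lyapunov f g \<beta> \<tau> Lf Lg H1 H2 H3 H4 x1 x2 x3 x4 lam k
                 - lyapunov f g \<beta> \<tau> Lf Lg H1 H2 H3 H4 x1 x2 x3 x4 lam (Suc k) \<ge> rhs
               \<and> rhs \<ge> 0)) \<and>
      diff_seq x1 \<longlonglongrightarrow> 0 \<and> diff_seq x2 \<longlonglongrightarrow> 0 \<and> diff_seq x3 \<longlonglongrightarrow> 0 \<and> diff_seq x4 \<longlonglongrightarrow> 0 \<and>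
      diff_seq lam \<longlonglongrightarrow> 0 \<and>
      (\<forall>y1 y2 y3 y4 mu.
         seq_limit_point (\<lambda>k. (x1 k, x2 k, x3 k, x4 k, lam k)) (y1, y2, y3, y4, mu) \<and>
         (closed M \<or> y1 \<in> M)
         \<longrightarrow> stationary M f g y1 y2 y3 y4 mu)"
proof -
  obtain h1 h2 h3 h4 where h_pos: "0 < h1" "0 < h2" "0 < h3" "0 < h4"
    and h_le: "\<And>x. h1 * (norm x)\<^sup>2 \<le> qnorm H1 x" "\<And>x. h2 * (norm x)\<^sup>2 \<le> qnorm H2 x"
      "\<And>x. h3 * (norm x)\<^sup>2 \<le> qnorm H3 x" "\<And>x. h4 * (norm x)\<^sup>2 \<le> qnorm H4 x"
    using assms(3-6)[THEN vertex_scaling_coercive] by blast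
  define h where "h = min (min h1 h2) (min h3 h4)"
  have h: "0 < h"
    using h_pos by (simp add: h_def)
  have h_min: "h \<le> h1" "h \<le> h2" "h \<le> h3" "h \<le> h4"
    by (simp_all add: h_def)
  have coercive: "h * (norm a)\<^sup>2 \<le> qnorm H1 a" "h * (norm a)\<^sup>2 \<le> qnorm H2 a"
    "h * (norm b)\<^sup>2 \<le> qnorm H3 b" "h * (norm b)\<^sup>2 \<le> qnorm H4 b" for a b
    by (rule order_trans[OF mult_right_mono h_le(1)] order_trans[OF mult_right_mono h_le(2)]
        order_trans[OF mult_right_mono h_le(3)] order_trans[OF mult_right_mono h_le(4)];
        use h_min in simp)+
  obtain C2 C4 where C_nonneg: "0 \<le> C2" "0 \<le> C4"
    and C_le: "\<And>x. (norm (H2 *v x))\<^sup>2 \<le> C2 * (norm x)\<^sup>2" "\<And>x. (norm (H4 *v x))\<^sup>2 \<le> C4 * (norm x)\<^sup>2"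
    using matrix_norm_sq_bound[of H2] matrix_norm_sq_bound[of H4] by blast
  define C where "C = C2 + C4"
  have C: "0 \<le> C" "(norm (H2 *v a))\<^sup>2 \<le> C * (norm a)\<^sup>2" "(norm (H4 *v b))\<^sup>2 \<le> C * (norm b)\<^sup>2" for a b
    using C_nonneg order_trans[OF C_le(1) mult_right_mono, of C a]
      order_trans[OF C_le(2) mult_right_mono, of C b] by (simp_all add: C_def)
  \<comment> \<open>The fraction is \<open>beta_large\<close> solved for \<beta>; it is nonnegative,
    and adding 1 makes the threshold positive. It involves only \<tau>, \<open>Lf\<close>,
    \<open>Lg\<close> and the matrices, so one value serves all data and runs.\<close>
  define \<beta>low where "\<beta>low = 8 * \<alpha>2 \<tau> * (7 * Lf\<^sup>2 + 4 * Lg\<^sup>2 + 4 * C) / h + 1"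
  have low: "0 < \<beta>low"
    using assms(1) C(1) h by (simp add: \<beta>low_def \<alpha>2_def add_nonneg_pos)
  show ?thesis
  proof (rule exI[of _ \<beta>low], intro conjI low allI impI; (elim conjE)?)
    fix \<beta> M f g R x1 x2 x3 x4 lam
    assume \<beta>: "\<beta>low < \<beta>"
      and asm: "assumption_A M f g R Lf Lg Lf1 Lf2 Lf3 Lf4 Lg1 Lg2"
      and run: "pradmm M f g \<beta> \<tau> H1 H2 H3 H4 x1 x2 x3 x4 lam"
      and bounds: "\<forall>k. norm (x1 k) \<le> R \<and> norm (x2 k) \<le> R \<and> norm (x3 k) \<le> R \<and> norm (x4 k) \<le> R"
      and lam: "bounded (range lam)"
    have large: "8 * \<alpha>2 \<tau> * (7 * Lf\<^sup>2 + 4 * Lg\<^sup>2 + 4 * C) \<le> \<beta> * h"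
      using \<beta> h by (simp add: \<beta>low_def field_simps)
    interpret pradmm_run M f g R Lf Lg Lf1 Lf2 Lf3 Lf4 Lg1 Lg2 \<beta> \<tau> H1 H2 H3 H4 x1 x2 x3 x4 lam h C
    proof qed (use assms(1,2) assms(3-6)[THEN vertex_scaling_symmetric] h coercive C low \<beta> large asm
        run bounds lam in auto)
    \<comment> \<open>The run lemmas are indexed by successors; \<open>k \<ge> 1\<close> lets
      \<open>k - 1\<close> play the role of their index.\<close>
    have decrease: "Q k + 2 * \<Psi> (Suc k) \<le> 2 * \<Psi> k" if "k \<ge> 1" for k
      using sufficient_decrease[of "k - 1"] that by simp
    have mono: "\<Psi> (Suc k) \<le> \<Psi> k" if "k \<ge> 1" for k
      using decrease[OF that] Q_nonneg[of k] by linarith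
    have half: "(1 - 1/2) * qnorm (M1 \<tau> \<beta> Lf Lg H1) (diff_seq x1 k)
        + (1 - 1/2) * qnorm (M2 \<tau> \<beta> Lf Lg H2) (diff_seq x2 k)
        + (1 - 1/2) * qnorm (M3 \<tau> \<beta> Lf H3) (diff_seq x3 k)
        + (1 - 1/2) * qnorm (M4 \<tau> \<beta> Lf H4) (diff_seq x4 k) = Q k / 2" for k
      by simp
    have half_le: "q / 2 \<le> a - b \<and> 0 \<le> q / 2" if "q + 2 * b \<le> 2 * a" "0 \<le> q" for q a b :: real
      using that by simp
    show "\<Psi> (Suc k) \<le> \<Psi> k" if "1 \<le> k" for k
      using mono that .
    show "\<exists>\<delta>1 \<delta>2 \<delta>3 \<delta>4 :: real.
         0 < \<delta>1 \<and> \<delta>1 < 1 \<and> 0 < \<delta>2 \<and> \<delta>2 < 1 \<and> 0 < \<delta>3 \<and> \<delta>3 < 1 \<and> 0 < \<delta>4 \<and> \<delta>4 < 1 \<and>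
         (\<forall>k\<ge>1.
            let rhs = (1 - \<delta>1) * qnorm (M1 \<tau> \<beta> Lf Lg H1) (diff_seq x1 k)
                    + (1 - \<delta>2) * qnorm (M2 \<tau> \<beta> Lf Lg H2) (diff_seq x2 k)
                    + (1 - \<delta>3) * qnorm (M3 \<tau> \<beta> Lf H3) (diff_seq x3 k)
                    + (1 - \<delta>4) * qnorm (M4 \<tau> \<beta> Lf H4) (diff_seq x4 k)
            in \<Psi> k - \<Psi> (Suc k) \<ge> rhs \<and> rhs \<ge> 0)"
    proof (intro exI[of _ "1/2"] conjI allI impI)
      fix k :: nat assume "1 \<le> k"
      then have "Q k / 2 \<le> \<Psi> k - \<Psi> (Suc k) \<and> 0 \<le> Q k / 2"
        using half_le[OF decrease Q_nonneg] by blast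
      then show "let rhs = (1 - 1/2) * qnorm (M1 \<tau> \<beta> Lf Lg H1) (diff_seq x1 k)
                    + (1 - 1/2) * qnorm (M2 \<tau> \<beta> Lf Lg H2) (diff_seq x2 k)
                    + (1 - 1/2) * qnorm (M3 \<tau> \<beta> Lf H3) (diff_seq x3 k)
                    + (1 - 1/2) * qnorm (M4 \<tau> \<beta> Lf H4) (diff_seq x4 k)
            in \<Psi> k - \<Psi> (Suc k) \<ge> rhs \<and> rhs \<ge> 0"
        unfolding half Let_def .
    qed simp_all
    show "diff_seq x1 \<longlonglongrightarrow> 0" "diff_seq x2 \<longlonglongrightarrow> 0" "diff_seq x3 \<longlonglongrightarrow> 0" "diff_seq x4 \<longlonglongrightarrow> 0"
      by (rule primal_diff_tendsto_0)+
    show "diff_seq lam \<longlonglongrightarrow> 0"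
      by (rule dual_diff_tendsto_0)
    show "stationary M f g y1 y2 y3 y4 mu"
      if "seq_limit_point (\<lambda>k. (x1 k, x2 k, x3 k, x4 k, lam k)) (y1, y2, y3, y4, mu)"
        "closed M \<or> y1 \<in> M" for y1 y2 y3 y4 mu
      using limit_point_stationary that unfolding seq_limit_point_def by blast
  qed
qed

end
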